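(* Let $(M^n,g)$ be a complete Hermitian manifold whose Bismut connection $\nabla^b$ is Ambrose-Singer, i.e. the torsion and curvature of $\nabla^b$ are parallel with respect to $\nabla^b$, and assume that the first Bismut Ricci curvature vanishes. If $(M^n,g)$ is Bismut Kähler-like, then it is Bismut flat, i.e. the curvature of $\nabla^b$ vanishes.
   Context: The Bismut connection $\nabla^b$ of a Hermitian manifold $(M,g)$ with complex structure $J$ is the unique connection with $\nabla^b g=0$, $\nabla^b J=0$ whose torsion is totally skew-symmetric. Write $R^b(x,y,z,w)=\langle \nabla^b_x\nabla^b_y z-\nabla^b_y\nabla^b_x z-\nabla^b_{[x,y]}z,\,w\rangle$ (extended complex multilinearly). The first Bismut Ricci is $\mathrm{Ric}^{b(1)}(x,y)=\sum_{i=1}^n R^b(x,y,e_i,\overline e_i)$ for a local unitary frame $e_1,\dots,e_n$ of $T^{1,0}M$. $(M,g)$ is Bismut Kähler-like if $R^b$ obeys all the Kähler symmetries: $R^b(x,y,z,\overline w)=0$ and $R^b(x,\overline y,z,\overline w)=R^b(z,\overline y,x,\overline w)$ for all type $(1,0)$ tangent vectors $x,y,z,w$. *)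

theory Defs
  imports "HOL-Analysis.Analysis"
begin

text \<open>
  Conventions. A complex manifold of dimension \<open>n = CARD('n)\<close> is a topology \<open>M\<close> with an atlas of
  charts into \<open>complex ^ 'n\<close>. In a chart the real tangent space at every point is
  \<open>complex ^ 'n\<close> as a real vector space, and the complex structure \<open>J\<close> is multiplication by \<open>\<i>\<close>.
  Tensor fields and connections are families of chart expressions, indexed by the charts of the atlas
  and subject to the transformation law on overlaps; a vector field on a chart domain is a smooth map
  from the image of the chart to \<open>complex ^ 'n\<close>. Linearity and differentiability refer to real scalars
  unless stated otherwise.
\<close>

primrec Ck_on :: "nat \<Rightarrow> ('a::real_normed_vector \<Rightarrow> 'b::real_normed_vector) \<Rightarrow> 'a set \<Rightarrow> bool" where
  "Ck_on 0 f S = continuous_on S f"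
| "Ck_on (Suc k) f S =
     ((\<forall>x\<in>S. f differentiable (at x)) \<and> (\<forall>v. Ck_on k (\<lambda>x. frechet_derivative f (at x) v) S))"

text \<open>Intended for open sets in finite dimensional spaces.\<close>

definition smooth_on :: "('a::real_normed_vector \<Rightarrow> 'b::real_normed_vector) \<Rightarrow> 'a set \<Rightarrow> bool" where
  "smooth_on f S \<longleftrightarrow> (\<forall>k. Ck_on k f S)"

definition holomorphic_map_on :: "(complex ^ 'n \<Rightarrow> complex ^ 'm) \<Rightarrow> (complex ^ 'n) set \<Rightarrow> bool" where
  "holomorphic_map_on f S \<longleftrightarrow>
     (\<forall>z\<in>S. \<exists>f'. (f has_derivative f') (at z) \<and> (\<forall>c v. f' (c *s v) = c *s f' v))"


subsection \<open>Complex manifolds\<close>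

type_synonym ('a, 'n) chart = "'a set \<times> ('a \<Rightarrow> complex ^ 'n)"

definition chart_image :: "('a, 'n::finite) chart \<Rightarrow> (complex ^ 'n) set" where
  "chart_image c = snd c ` fst c"

definition overlap :: "('a, 'n::finite) chart \<Rightarrow> ('a, 'n) chart \<Rightarrow> (complex ^ 'n) set" where
  "overlap c d = snd c ` (fst c \<inter> fst d)"

definition transition :: "('a, 'n::finite) chart \<Rightarrow> ('a, 'n) chart \<Rightarrow> complex ^ 'n \<Rightarrow> complex ^ 'n" where
  "transition c d = snd d \<circ> inv_into (fst c) (snd c)"

definition second_countable :: "'a topology \<Rightarrow> bool" where
  "second_countable M \<longleftrightarrow>
     (\<exists>\<B>. countable \<B> \<and> (\<forall>B\<in>\<B>. openin M B) \<and>
        (\<forall>U x. openin M U \<and> x \<in> U \<longrightarrow> (\<exists>B\<in>\<B>. x \<in> B \<and> B \<subseteq> U)))"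

definition complex_manifold :: "'a topology \<Rightarrow> ('a, 'n::finite) chart set \<Rightarrow> bool" where
  "complex_manifold M A \<longleftrightarrow>
     Hausdorff_space M \<and> second_countable M \<and>
     (\<forall>c\<in>A. openin M (fst c) \<and> open (chart_image c) \<and>
        homeomorphic_map (subtopology M (fst c)) (top_of_set (chart_image c)) (snd c)) \<and>
     (\<Union>c\<in>A. fst c) = topspace M \<and>
     (\<forall>c\<in>A. \<forall>d\<in>A. holomorphic_map_on (transition c d) (overlap c d))"

abbreviation J :: "complex ^ 'n \<Rightarrow> complex ^ 'n" where
  "J v \<equiv> \<i> *s v"


subsection \<open>Hermitian metrics and completeness\<close>

type_synonym 'n chart_form = "complex ^ 'n \<Rightarrow> complex ^ 'n \<Rightarrow> complex ^ 'n \<Rightarrow> real"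

text \<open>The Hermitian metric is given by its underlying \<open>J\<close>-invariant Riemannian metric:
  \<open>g c z v w\<close> is the inner product of the tangent vectors \<open>v\<close>, \<open>w\<close> at \<open>z\<close> in the chart \<open>c\<close>.\<close>

definition hermitian_metric ::
  "('a, 'n::finite) chart set \<Rightarrow> (('a, 'n) chart \<Rightarrow> 'n chart_form) \<Rightarrow> bool" where
  "hermitian_metric A g \<longleftrightarrow>
     (\<forall>c\<in>A. (\<forall>v w. smooth_on (\<lambda>z. g c z v w) (chart_image c)) \<and>
        (\<forall>z\<in>chart_image c. bilinear (g c z) \<and>
           (\<forall>v w. g c z v w = g c z w v) \<and>
           (\<forall>v. v \<noteq> 0 \<longrightarrow> 0 < g c z v v) \<and>
           (\<forall>v w. g c z (J v) (J w) = g c z v w))) \<and>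
     (\<forall>c\<in>A. \<forall>d\<in>A. \<forall>z\<in>overlap c d. \<forall>v w.
        g d (transition c d z)
          (frechet_derivative (transition c d) (at z) v)
          (frechet_derivative (transition c d) (at z) w) = g c z v w)"

definition piecewise_C1_curve ::
  "'a topology \<Rightarrow> ('a, 'n::finite) chart set \<Rightarrow> (real \<Rightarrow> 'a) \<Rightarrow> bool" where
  "piecewise_C1_curve M A \<gamma> \<longleftrightarrow>
     continuous_map (top_of_set {0..1}) M \<gamma> \<and>
     (\<forall>c\<in>A. \<forall>a b. 0 \<le> a \<and> a \<le> b \<and> b \<le> 1 \<and> \<gamma> ` {a..b} \<subseteq> fst c \<longrightarrow>
        (snd c \<circ> \<gamma>) piecewise_C1_differentiable_on {a..b})"

text \<open>By the transformation law of \<open>g\<close> the speed does not depend on the chosen chart,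
  except possibly at the finitely many exceptional parameters.\<close>

definition speed ::
  "('a, 'n::finite) chart set \<Rightarrow> (('a, 'n) chart \<Rightarrow> 'n chart_form) \<Rightarrow> (real \<Rightarrow> 'a) \<Rightarrow> real \<Rightarrow> real" where
  "speed A g \<gamma> t =
     (let c = (SOME c. c \<in> A \<and> \<gamma> t \<in> fst c);
          v = vector_derivative (snd c \<circ> \<gamma>) (at t)
      in sqrt (g c (snd c (\<gamma> t)) v v))"

text \<open>The length is an \<open>ennreal\<close>-valued Lebesgue integral, since a curve of this kind may have
  infinite length. The distance between different components of \<open>M\<close> is \<open>\<infinity>\<close>.\<close>

definition curve_length ::
  "('a, 'n::finite) chart set \<Rightarrow> (('a, 'n) chart \<Rightarrow> 'n chart_form) \<Rightarrow> (real \<Rightarrow> 'a) \<Rightarrow> ennreal" where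
  "curve_length A g \<gamma> = (\<integral>\<^sup>+ t\<in>{0..1}. ennreal (speed A g \<gamma> t) \<partial>lborel)"

definition riemannian_distance ::
  "'a topology \<Rightarrow> ('a, 'n::finite) chart set \<Rightarrow> (('a, 'n) chart \<Rightarrow> 'n chart_form) \<Rightarrow>
   'a \<Rightarrow> 'a \<Rightarrow> ennreal" where
  "riemannian_distance M A g p q =
     Inf {curve_length A g \<gamma> | \<gamma>. piecewise_C1_curve M A \<gamma> \<and> \<gamma> 0 = p \<and> \<gamma> 1 = q}"

definition complete_metric ::
  "'a topology \<Rightarrow> ('a, 'n::finite) chart set \<Rightarrow> (('a, 'n) chart \<Rightarrow> 'n chart_form) \<Rightarrow> bool" where
  "complete_metric M A g \<longleftrightarrow>
     (\<forall>\<sigma> :: nat \<Rightarrow> 'a.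
        range \<sigma> \<subseteq> topspace M \<and>
        (\<forall>\<epsilon>>0. \<exists>N. \<forall>i\<ge>N. \<forall>j\<ge>N. riemannian_distance M A g (\<sigma> i) (\<sigma> j) < \<epsilon>) \<longrightarrow>
        (\<exists>p. limitin M \<sigma> p sequentially))"


subsection \<open>Connections\<close>

text \<open>\<open>\<Gamma> z v w\<close> are the Christoffel symbols of a connection in a chart, contracted with \<open>v\<close> and
  \<open>w\<close>; \<open>cov \<Gamma> X Y\<close> is the covariant derivative of the vector field \<open>Y\<close> along \<open>X\<close>.\<close>

type_synonym 'n vfield = "complex ^ 'n \<Rightarrow> complex ^ 'n"
type_synonym 'n christoffel = "complex ^ 'n \<Rightarrow> complex ^ 'n \<Rightarrow> complex ^ 'n \<Rightarrow> complex ^ 'n"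

definition cov :: "'n::finite christoffel \<Rightarrow> 'n vfield \<Rightarrow> 'n vfield \<Rightarrow> 'n vfield" where
  "cov \<Gamma> X Y = (\<lambda>z. frechet_derivative Y (at z) (X z) + \<Gamma> z (X z) (Y z))"

text \<open>The overlap condition says that the covariant derivative is invariant under change of chart.\<close>

definition affine_connection ::
  "('a, 'n::finite) chart set \<Rightarrow> (('a, 'n) chart \<Rightarrow> 'n christoffel) \<Rightarrow> bool" where
  "affine_connection A \<Gamma> \<longleftrightarrow>
     (\<forall>c\<in>A. (\<forall>v w. smooth_on (\<lambda>z. \<Gamma> c z v w) (chart_image c)) \<and>
        (\<forall>z\<in>chart_image c. bilinear (\<Gamma> c z))) \<and>
     (\<forall>c\<in>A. \<forall>d\<in>A. \<forall>X Y X' Y'.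
        smooth_on X (overlap c d) \<and> smooth_on Y (overlap c d) \<and>
        smooth_on X' (overlap d c) \<and> smooth_on Y' (overlap d c) \<and>
        (\<forall>z\<in>overlap c d.
           X' (transition c d z) = frechet_derivative (transition c d) (at z) (X z) \<and>
           Y' (transition c d z) = frechet_derivative (transition c d) (at z) (Y z)) \<longrightarrow>
        (\<forall>z\<in>overlap c d.
           cov (\<Gamma> d) X' Y' (transition c d z) =
           frechet_derivative (transition c d) (at z) (cov (\<Gamma> c) X Y z)))"

definition lie_bracket :: "'n::finite vfield \<Rightarrow> 'n vfield \<Rightarrow> 'n vfield" where
  "lie_bracket X Y =
     (\<lambda>z. frechet_derivative Y (at z) (X z) - frechet_derivative X (at z) (Y z))"

definition torsion :: "'n::finite christoffel \<Rightarrow> 'n vfield \<Rightarrow> 'n vfield \<Rightarrow> 'n vfield" where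
  "torsion \<Gamma> X Y = (\<lambda>z. cov \<Gamma> X Y z - cov \<Gamma> Y X z - lie_bracket X Y z)"

definition curvature ::
  "'n::finite christoffel \<Rightarrow> 'n vfield \<Rightarrow> 'n vfield \<Rightarrow> 'n vfield \<Rightarrow> 'n vfield" where
  "curvature \<Gamma> X Y Z =
     (\<lambda>z. cov \<Gamma> X (cov \<Gamma> Y Z) z - cov \<Gamma> Y (cov \<Gamma> X Z) z - cov \<Gamma> (lie_bracket X Y) Z z)"

definition bismut_connection ::
  "('a, 'n::finite) chart set \<Rightarrow> (('a, 'n) chart \<Rightarrow> 'n chart_form) \<Rightarrow>
   (('a, 'n) chart \<Rightarrow> 'n christoffel) \<Rightarrow> bool" where
  "bismut_connection A g \<Gamma> \<longleftrightarrow>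
     affine_connection A \<Gamma> \<and>
     (\<forall>c\<in>A. \<forall>X Y Z.
        smooth_on X (chart_image c) \<and> smooth_on Y (chart_image c) \<and> smooth_on Z (chart_image c) \<longrightarrow>
        (\<forall>z\<in>chart_image c.
           frechet_derivative (\<lambda>u. g c u (Y u) (Z u)) (at z) (X z) =
             g c z (cov (\<Gamma> c) X Y z) (Z z) + g c z (Y z) (cov (\<Gamma> c) X Z z) \<and>
           cov (\<Gamma> c) X (\<lambda>u. J (Y u)) z = J (cov (\<Gamma> c) X Y z) \<and>
           g c z (torsion (\<Gamma> c) X Y z) (Z z) = - g c z (torsion (\<Gamma> c) Y X z) (Z z) \<and>
           g c z (torsion (\<Gamma> c) X Y z) (Z z) = - g c z (torsion (\<Gamma> c) X Z z) (Y z)))"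

definition parallel_torsion ::
  "('a, 'n::finite) chart set \<Rightarrow> (('a, 'n) chart \<Rightarrow> 'n christoffel) \<Rightarrow> bool" where
  "parallel_torsion A \<Gamma> \<longleftrightarrow>
     (\<forall>c\<in>A. \<forall>W X Y.
        smooth_on W (chart_image c) \<and> smooth_on X (chart_image c) \<and> smooth_on Y (chart_image c) \<longrightarrow>
        (\<forall>z\<in>chart_image c.
           cov (\<Gamma> c) W (torsion (\<Gamma> c) X Y) z
           - torsion (\<Gamma> c) (cov (\<Gamma> c) W X) Y z
           - torsion (\<Gamma> c) X (cov (\<Gamma> c) W Y) z = 0))"

definition parallel_curvature ::
  "('a, 'n::finite) chart set \<Rightarrow> (('a, 'n) chart \<Rightarrow> 'n christoffel) \<Rightarrow> bool" where
  "parallel_curvature A \<Gamma> \<longleftrightarrow>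
     (\<forall>c\<in>A. \<forall>W X Y Z.
        smooth_on W (chart_image c) \<and> smooth_on X (chart_image c) \<and>
        smooth_on Y (chart_image c) \<and> smooth_on Z (chart_image c) \<longrightarrow>
        (\<forall>z\<in>chart_image c.
           cov (\<Gamma> c) W (curvature (\<Gamma> c) X Y Z) z
           - curvature (\<Gamma> c) (cov (\<Gamma> c) W X) Y Z z
           - curvature (\<Gamma> c) X (cov (\<Gamma> c) W Y) Z z
           - curvature (\<Gamma> c) X Y (cov (\<Gamma> c) W Z) z = 0))"

definition ambrose_singer ::
  "('a, 'n::finite) chart set \<Rightarrow> (('a, 'n) chart \<Rightarrow> 'n christoffel) \<Rightarrow> bool" where
  "ambrose_singer A \<Gamma> \<longleftrightarrow> parallel_torsion A \<Gamma> \<and> parallel_curvature A \<Gamma>"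

definition flat_connection ::
  "('a, 'n::finite) chart set \<Rightarrow> (('a, 'n) chart \<Rightarrow> 'n christoffel) \<Rightarrow> bool" where
  "flat_connection A \<Gamma> \<longleftrightarrow>
     (\<forall>c\<in>A. \<forall>X Y Z.
        smooth_on X (chart_image c) \<and> smooth_on Y (chart_image c) \<and> smooth_on Z (chart_image c) \<longrightarrow>
        (\<forall>z\<in>chart_image c. curvature (\<Gamma> c) X Y Z z = 0))"


subsection \<open>Complexified tangent vectors\<close>

text \<open>The pair \<open>(a, b)\<close> stands for the complexified tangent vector \<open>a + \<i> b\<close>. Its formal imaginary
  unit, which sends \<open>(a, b)\<close> to \<open>(- b, a)\<close>, is different from \<open>J\<close>, which acts on both components;
  the two agree on the vectors of type (1,0).\<close>

type_synonym 'n cvec = "(complex ^ 'n) \<times> (complex ^ 'n)"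

definition conj_vec :: "'n::finite cvec \<Rightarrow> 'n cvec" where
  "conj_vec v = (fst v, - snd v)"

definition type_10 :: "'n::finite cvec \<Rightarrow> bool" where
  "type_10 v \<longleftrightarrow> (J (fst v), J (snd v)) = (- snd v, fst v)"

text \<open>Complex linear extension of a real linear function, applied below in each argument.\<close>

definition cext :: "(complex ^ 'n::finite \<Rightarrow> complex) \<Rightarrow> 'n cvec \<Rightarrow> complex" where
  "cext f v = f (fst v) + \<i> * f (snd v)"

definition metricC ::
  "'n::finite chart_form \<Rightarrow> complex ^ 'n \<Rightarrow> 'n cvec \<Rightarrow> 'n cvec \<Rightarrow> complex" where
  "metricC g z x y = cext (\<lambda>a. cext (\<lambda>b. complex_of_real (g z a b)) y) x"

text \<open>The curvature is tensorial, so its value on tangent vectors at \<open>z\<close> may be computed with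
  any extension to vector fields; we use the extensions that are constant in the chart.\<close>

definition curvature4 ::
  "'n::finite chart_form \<Rightarrow> 'n christoffel \<Rightarrow> complex ^ 'n \<Rightarrow>
   complex ^ 'n \<Rightarrow> complex ^ 'n \<Rightarrow> complex ^ 'n \<Rightarrow> complex ^ 'n \<Rightarrow> real" where
  "curvature4 g \<Gamma> z a b c d = g z (curvature \<Gamma> (\<lambda>_. a) (\<lambda>_. b) (\<lambda>_. c) z) d"

definition curvatureC ::
  "'n::finite chart_form \<Rightarrow> 'n christoffel \<Rightarrow> complex ^ 'n \<Rightarrow>
   'n cvec \<Rightarrow> 'n cvec \<Rightarrow> 'n cvec \<Rightarrow> 'n cvec \<Rightarrow> complex" where
  "curvatureC g \<Gamma> z x y u v =
     cext (\<lambda>a. cext (\<lambda>b. cext (\<lambda>c. cext (\<lambda>d.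
       complex_of_real (curvature4 g \<Gamma> z a b c d)) v) u) y) x"

definition unitary_frame :: "'n::finite chart_form \<Rightarrow> complex ^ 'n \<Rightarrow> ('n \<Rightarrow> 'n cvec) \<Rightarrow> bool" where
  "unitary_frame g z e \<longleftrightarrow>
     (\<forall>i. type_10 (e i)) \<and>
     (\<forall>i j. metricC g z (e i) (conj_vec (e j)) = (if i = j then 1 else 0))"

definition first_ricci ::
  "'n::finite chart_form \<Rightarrow> 'n christoffel \<Rightarrow> complex ^ 'n \<Rightarrow> ('n \<Rightarrow> 'n cvec) \<Rightarrow>
   'n cvec \<Rightarrow> 'n cvec \<Rightarrow> complex" where
  "first_ricci g \<Gamma> z e x y = (\<Sum>i\<in>UNIV. curvatureC g \<Gamma> z x y (e i) (conj_vec (e i)))"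

text \<open>The first Ricci form does not depend on the unitary frame, and at a given point only
  the value of the frame at that point matters.\<close>

definition first_ricci_vanishes ::
  "('a, 'n::finite) chart set \<Rightarrow> (('a, 'n) chart \<Rightarrow> 'n chart_form) \<Rightarrow>
   (('a, 'n) chart \<Rightarrow> 'n christoffel) \<Rightarrow> bool" where
  "first_ricci_vanishes A g \<Gamma> \<longleftrightarrow>
     (\<forall>c\<in>A. \<forall>z\<in>chart_image c. \<forall>e. unitary_frame (g c) z e \<longrightarrow>
        (\<forall>x y. first_ricci (g c) (\<Gamma> c) z e x y = 0))"

definition kaehler_like ::
  "('a, 'n::finite) chart set \<Rightarrow> (('a, 'n) chart \<Rightarrow> 'n chart_form) \<Rightarrow>
   (('a, 'n) chart \<Rightarrow> 'n christoffel) \<Rightarrow> bool" where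
  "kaehler_like A g \<Gamma> \<longleftrightarrow>
     (\<forall>c\<in>A. \<forall>z\<in>chart_image c. \<forall>x y u v.
        type_10 x \<and> type_10 y \<and> type_10 u \<and> type_10 v \<longrightarrow>
        curvatureC (g c) (\<Gamma> c) z x y u (conj_vec v) = 0 \<and>
        curvatureC (g c) (\<Gamma> c) z x (conj_vec y) u (conj_vec v) =
        curvatureC (g c) (\<Gamma> c) z u (conj_vec y) x (conj_vec v))"

end

theory Submission
  imports Defs
begin

text \<open>
  The claim is pointwise: a Ricci-flat curvature tensor \<open>R\<close> with the Kaehler symmetries that is
  annihilated by its own holonomy, \<open>R(a, b) \<cdot> R = 0\<close>, is zero. The last condition holds here because
  \<open>R\<close> is parallel, so that the commutator of two covariant derivatives, which is the
  action of \<open>R(a, b)\<close> as a derivation, kills \<open>R\<close> (\<open>R_derivation_of_parallel\<close>). Algebraically \<open>R\<close>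
  is then the curvature tensor of a Hermitian symmetric space, and the statement is that a
  Ricci-flat Hermitian symmetric space is flat.

  The proof uses Jordan triple systems instead of the structure theory of symmetric spaces.
  On complexified vectors, \<open>P(x, y) w = R(x, conj y) w\<close> is complex linear in \<open>x\<close>, \<open>w\<close> and antilinear in
  \<open>y\<close>, and in real terms \<open>P(x, y) w = (R(x, y) w + J R(x, J y) w) / 2\<close>. The Kaehler symmetries say that \<open>P\<close> is symmetric in
  \<open>x\<close> and \<open>w\<close> and that \<open>P(y, x)\<close> is the adjoint of \<open>P(x, y)\<close>; the derivation property of \<open>R\<close> becomes the
  Jordan triple identity. Suppose that some cube \<open>P(x, x) x\<close> is not zero. Maximizing the absolute value of the
  holomorphic sectional curvature \<open>\<langle>P(x, x) x, x\<rangle> / \<langle>x, x\<rangle>\<^sup>2\<close> over the unit sphere yields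
  \<open>e\<close> with \<open>P(e, e) e = l e\<close> and \<open>l \<noteq> 0\<close> (\<open>exists_tripotent\<close>). The Peirce decomposition with respect to \<open>e\<close>
  says that the self-adjoint operator \<open>P(e, e)\<close> has its eigenvalues in \<open>{0, l/2, l}\<close>, whence its trace has
  the sign of \<open>l\<close> and is not zero (\<open>peirce_form_ge\<close>). But up to a factor this trace is the Ricci curvature
  \<open>Ric(e, J e)\<close>, a contradiction. So all cubes vanish; by polarization \<open>P = 0\<close>,
  and \<open>R(x, y) = P(x, y) - P(y, x) = 0\<close> (\<open>ricci_flat_imp_zero\<close>).

  The differential geometry takes place in one chart. It shows that the curvature is tensorial
  and has the symmetries coming from \<open>\<nabla>g = 0\<close> and \<open>\<nabla>J = 0\<close>. Tensoriality and the skew-symmetry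
  with respect to \<open>g\<close> rest on the symmetry of second derivatives.
\<close>

section \<open>Smooth maps and fields of linear maps\<close>

lemma frechet_derivative_eqI:
  "(f has_derivative D) (at x) \<Longrightarrow> frechet_derivative f (at x) v = D v"
  by (simp add: frechet_derivative_at[symmetric])

lemma Ck_on_cong:
  assumes "open S" and "\<And>x. x \<in> S \<Longrightarrow> f x = g x"
  shows "Ck_on k f S \<longleftrightarrow> Ck_on k g S"
  using assms(2)
proof (induction k arbitrary: f g)
  case 0
  then show ?case by (simp cong: continuous_on_cong)
next
  case (Suc k)
  have imp: "Ck_on (Suc k) h' S" if h: "Ck_on (Suc k) h S" and eq: "\<And>x. x \<in> S \<Longrightarrow> h x = h' x"
    for h h' :: "'a \<Rightarrow> 'b"
  proof -
    have "(h' has_derivative frechet_derivative h (at x)) (at x)" if "x \<in> S" for x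
      using has_derivative_transform_within_open[OF _ \<open>open S\<close> that eq] h that
      by (auto simp: frechet_derivative_works)
    then have d: "h' differentiable (at x)"
      "frechet_derivative h (at x) = frechet_derivative h' (at x)" if "x \<in> S" for x
      using that by (auto simp: differentiable_def intro: frechet_derivative_at)
    then show ?thesis
      using h Suc.IH[of "\<lambda>x. frechet_derivative h (at x) _" "\<lambda>x. frechet_derivative h' (at x) _"] by auto
  qed
  show ?case
    using imp[of f g] imp[of g f] Suc.prems by metis
qed

lemma smooth_on_cong:
  "open S \<Longrightarrow> (\<And>x. x \<in> S \<Longrightarrow> f x = g x) \<Longrightarrow> smooth_on f S \<longleftrightarrow> smooth_on g S"
  unfolding smooth_on_def by (blast dest: Ck_on_cong)

lemma smooth_on_differentiable: "smooth_on f S \<Longrightarrow> x \<in> S \<Longrightarrow> f differentiable (at x)"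
  unfolding smooth_on_def by (metis Ck_on.simps(2))

lemma smooth_on_frechet_derivative:
  "smooth_on f S \<Longrightarrow> smooth_on (\<lambda>x. frechet_derivative f (at x) v) S"
  unfolding smooth_on_def by (metis Ck_on.simps(2))

lemma smooth_on_imp_continuous_on: "smooth_on f S \<Longrightarrow> continuous_on S f"
  unfolding smooth_on_def by (metis Ck_on.simps(1))

lemma smooth_on_const: "smooth_on (\<lambda>x. c) S"
proof -
  have "Ck_on k (\<lambda>x. c) S" for k
    by (induction k arbitrary: c) auto
  then show ?thesis by (simp add: smooth_on_def)
qed

text \<open>
  The regularity classes are defined through the values of the directional derivatives, so
  every closure property is an induction on \<open>k\<close>. The derivative of the new function is
  known only on \<open>S\<close>, which is why the congruence rule for open sets is needed.
\<close>

lemma Ck_on_add: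
  assumes "open S" "Ck_on k f S" "Ck_on k g S"
  shows "Ck_on k (\<lambda>x. f x + g x) S"
  using assms(2,3)
proof (induction k arbitrary: f g)
  case 0
  then show ?case by (simp add: continuous_on_add)
next
  case (Suc k)
  have D: "((\<lambda>x. f x + g x) has_derivative
      (\<lambda>v. frechet_derivative f (at x) v + frechet_derivative g (at x) v)) (at x)" if "x \<in> S" for x
    using Suc.prems that by (intro has_derivative_add) (auto simp: frechet_derivative_works)
  have "Ck_on k (\<lambda>x. frechet_derivative (\<lambda>x. f x + g x) (at x) v) S" for v
    by (subst Ck_on_cong[OF \<open>open S\<close>, where g="\<lambda>x. frechet_derivative f (at x) v + frechet_derivative g (at x) v"])
       (use Suc D in \<open>auto simp: frechet_derivative_eqI[OF D]\<close>)
  then show ?case using D by (auto simp: differentiable_def)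
qed

lemma smooth_on_add:
  "open S \<Longrightarrow> smooth_on f S \<Longrightarrow> smooth_on g S \<Longrightarrow> smooth_on (\<lambda>x. f x + g x) S"
  by (simp add: smooth_on_def Ck_on_add)

lemma smooth_on_sum:
  assumes "open S" and "\<And>i. i \<in> I \<Longrightarrow> smooth_on (f i) S"
  shows "smooth_on (\<lambda>x. \<Sum>i\<in>I. f i x) S"
  using assms(2) by (induction I rule: infinite_finite_induct)
    (auto intro: smooth_on_const smooth_on_add[OF assms(1)])

lemma smooth_on_bounded_linear:
  assumes "open S" "bounded_linear L" "smooth_on f S"
  shows "smooth_on (\<lambda>x. L (f x)) S"
proof -
  have "Ck_on k (\<lambda>x. L (f x)) S" for k
    using assms(3)
  proof (induction k arbitrary: f)
    case 0
    then show ?case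
      using bounded_linear.continuous_on[OF assms(2)] smooth_on_imp_continuous_on by auto
  next
    case (Suc k)
    have D: "((\<lambda>x. L (f x)) has_derivative (\<lambda>v. L (frechet_derivative f (at x) v))) (at x)" if "x \<in> S" for x
      using smooth_on_differentiable[OF Suc.prems that]
      by (intro bounded_linear.has_derivative[OF assms(2)]) (auto simp: frechet_derivative_works)
    have "Ck_on k (\<lambda>x. frechet_derivative (\<lambda>x. L (f x)) (at x) v) S" for v
      by (subst Ck_on_cong[OF \<open>open S\<close>, where g="\<lambda>x. L (frechet_derivative f (at x) v)"])
         (use Suc D in \<open>auto simp: frechet_derivative_eqI[OF D] smooth_on_frechet_derivative\<close>)
    then show ?case using D by (auto simp: differentiable_def)
  qed
  then show ?thesis by (simp add: smooth_on_def)
qed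

lemma smooth_on_diff:
  fixes f g :: "'a::real_normed_vector \<Rightarrow> 'b::real_normed_vector"
  assumes "open S" "smooth_on f S" "smooth_on g S"
  shows "smooth_on (\<lambda>x. f x - g x) S"
  using smooth_on_add[OF assms(1,2) smooth_on_bounded_linear[OF assms(1) bounded_linear_minus[OF bounded_linear_ident] assms(3)]]
  by simp

text \<open>
  The factors are kept smooth of all orders in the induction: the derivative of the product contains the
  factors themselves, for which the hypothesis of one order less would have to be derived.
\<close>

lemma smooth_on_scaleR:
  fixes f :: "'a::real_normed_vector \<Rightarrow> real" and g :: "'a \<Rightarrow> 'b::real_normed_vector"
  assumes "open S" "smooth_on f S" "smooth_on g S"
  shows "smooth_on (\<lambda>x. f x *\<^sub>R g x) S"
proof -
  have "Ck_on k (\<lambda>x. f x *\<^sub>R g x) S" for k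
    using assms(2,3)
  proof (induction k arbitrary: f g)
    case 0
    then show ?case
      by (simp add: continuous_on_scaleR smooth_on_imp_continuous_on)
  next
    case (Suc k)
    have D: "((\<lambda>x. f x *\<^sub>R g x) has_derivative
        (\<lambda>v. f x *\<^sub>R frechet_derivative g (at x) v + frechet_derivative f (at x) v *\<^sub>R g x)) (at x)" if "x \<in> S" for x
      using smooth_on_differentiable[OF Suc.prems(1) that] smooth_on_differentiable[OF Suc.prems(2) that]
      by (intro has_derivative_scaleR) (simp_all add: frechet_derivative_works)
    have "Ck_on k (\<lambda>x. frechet_derivative (\<lambda>x. f x *\<^sub>R g x) (at x) v) S" for v
      by (subst Ck_on_cong[OF \<open>open S\<close>, where g="\<lambda>x. f x *\<^sub>R frechet_derivative g (at x) v + frechet_derivative f (at x) v *\<^sub>R g x"])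
         (use Suc D in \<open>auto simp: frechet_derivative_eqI[OF D] smooth_on_frechet_derivative intro!: Ck_on_add[OF \<open>open S\<close>]\<close>)
    then show ?case using D by (auto simp: differentiable_def)
  qed
  then show ?thesis by (simp add: smooth_on_def)
qed

lemma linear_eq_sum_Basis:
  assumes "linear (L :: 'a::euclidean_space \<Rightarrow> 'b::real_vector)"
  shows "L y = (\<Sum>b\<in>Basis. (y \<bullet> b) *\<^sub>R L b)"
proof -
  have "L y = L (\<Sum>b\<in>Basis. (y \<bullet> b) *\<^sub>R b)" by (simp add: euclidean_representation)
  also have "\<dots> = (\<Sum>b\<in>Basis. (y \<bullet> b) *\<^sub>R L b)"
    using assms by (simp add: linear_sum linear_scale)
  finally show ?thesis .
qed

text \<open>
  A tensor field in a chart is a family of linear maps whose values on fixed vectors are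
  smooth. Expanding the argument in the standard basis reduces its evaluation on a vector
  field to sums of products.
\<close>

lemma smooth_on_linear_field:
  fixes L :: "'c::real_normed_vector \<Rightarrow> 'a::euclidean_space \<Rightarrow> 'b::real_normed_vector"
  assumes "open S" "\<And>u. u \<in> S \<Longrightarrow> linear (L u)" "\<And>b. smooth_on (\<lambda>u. L u b) S" "smooth_on Y S"
  shows "smooth_on (\<lambda>u. L u (Y u)) S"
proof -
  have "smooth_on (\<lambda>u. \<Sum>b\<in>Basis. (Y u \<bullet> b) *\<^sub>R L u b) S"
    by (intro smooth_on_sum smooth_on_scaleR assms
         smooth_on_bounded_linear[OF _ bounded_linear_inner_left])
  then show ?thesis
    by (subst smooth_on_cong[OF assms(1), where g="\<lambda>u. \<Sum>b\<in>Basis. (Y u \<bullet> b) *\<^sub>R L u b"])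
       (auto simp: linear_eq_sum_Basis[OF assms(2)])
qed

lemma smooth_on_bilinear_field:
  fixes G :: "'c::real_normed_vector \<Rightarrow> 'a::euclidean_space \<Rightarrow> 'b::euclidean_space \<Rightarrow> 'd::real_normed_vector"
  assumes "open S" "\<And>u. u \<in> S \<Longrightarrow> bilinear (G u)" "\<And>a b. smooth_on (\<lambda>u. G u a b) S"
    "smooth_on X S" "smooth_on Y S"
  shows "smooth_on (\<lambda>u. G u (X u) (Y u)) S"
proof -
  have lin: "linear (G u a)" "linear (\<lambda>a. G u a b)" if "u \<in> S" for u a b
    using assms(2)[OF that] by (simp_all add: bilinear_def)
  have "smooth_on (\<lambda>u. G u (X u) b) S" for b
    by (rule smooth_on_linear_field[where L="\<lambda>u a. G u a b", OF assms(1) lin(2) assms(3,4)])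
  note X_field = this
  show ?thesis
    by (rule smooth_on_linear_field[where L="\<lambda>u. G u (X u)", OF assms(1) lin(1) X_field assms(5)])
qed

text \<open>
  The product rule for a tensor field evaluated on a vector field. Differentiability of \<open>L\<close> is
  asked only on fixed vectors, so no norm on a space of linear maps is involved.
\<close>

lemma has_derivative_linear_field:
  fixes L :: "'c::real_normed_vector \<Rightarrow> 'a::euclidean_space \<Rightarrow> 'b::real_normed_vector"
  assumes S: "open S" "z \<in> S" and lin: "\<And>u. u \<in> S \<Longrightarrow> linear (L u)"
    and L': "\<And>b. ((\<lambda>u. L u b) has_derivative L' b) (at z)"
    and Y: "(Y has_derivative Y') (at z)"
  shows "((\<lambda>u. L u (Y u)) has_derivative (\<lambda>v. L' (Y z) v + L z (Y' v))) (at z)"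
proof -
  have 1: "((\<lambda>u. L u y) has_derivative (\<lambda>v. \<Sum>b\<in>Basis. (y \<bullet> b) *\<^sub>R L' b v)) (at z)" for y
    by (rule has_derivative_transform_within_open[OF _ S, where f="\<lambda>u. \<Sum>b\<in>Basis. (y \<bullet> b) *\<^sub>R L u b"])
      (auto intro!: derivative_eq_intros L' simp: linear_eq_sum_Basis[OF lin, of _ y])
  \<comment> \<open>Linearity of the derivative in the fixed vector follows from uniqueness of derivatives.\<close>
  have 2: "L' y = (\<lambda>v. \<Sum>b\<in>Basis. (y \<bullet> b) *\<^sub>R L' b v)" for y
    by (rule has_derivative_unique[OF L' 1])
  have "((\<lambda>u. \<Sum>b\<in>Basis. (Y u \<bullet> b) *\<^sub>R L u b) has_derivative
      (\<lambda>v. \<Sum>b\<in>Basis. (Y z \<bullet> b) *\<^sub>R L' b v + (Y' v \<bullet> b) *\<^sub>R L z b)) (at z)"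
    by (intro has_derivative_sum has_derivative_scaleR L' has_derivative_inner_left Y)
  then have "((\<lambda>u. L u (Y u)) has_derivative
      (\<lambda>v. \<Sum>b\<in>Basis. (Y z \<bullet> b) *\<^sub>R L' b v + (Y' v \<bullet> b) *\<^sub>R L z b)) (at z)"
    by (rule has_derivative_transform_within_open[OF _ S]) (simp add: linear_eq_sum_Basis[OF lin, of _ "Y _"])
  moreover have "(\<lambda>v. \<Sum>b\<in>Basis. (Y z \<bullet> b) *\<^sub>R L' b v + (Y' v \<bullet> b) *\<^sub>R L z b) = (\<lambda>v. L' (Y z) v + L z (Y' v))"
    by (simp add: sum.distrib fun_cong[OF 2[of "Y z"]] linear_eq_sum_Basis[OF lin[OF S(2)], of "Y' _"])
  ultimately show ?thesis by simp
qed

lemma frechet_derivative_linear_field: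
  fixes L :: "'c::real_normed_vector \<Rightarrow> 'a::euclidean_space \<Rightarrow> 'b::real_normed_vector"
  assumes S: "open S" "z \<in> S" and lin: "\<And>u. u \<in> S \<Longrightarrow> linear (L u)"
    and L: "\<And>b. (\<lambda>u. L u b) differentiable (at z)" and Y: "Y differentiable (at z)"
  shows "\<And>v. frechet_derivative (\<lambda>u. L u (Y u)) (at z) v =
    frechet_derivative (\<lambda>u. L u (Y z)) (at z) v + L z (frechet_derivative Y (at z) v)"
    and "(\<lambda>u. L u (Y u)) differentiable (at z)"
proof -
  have L': "((\<lambda>u. L u b) has_derivative frechet_derivative (\<lambda>u. L u b) (at z)) (at z)" for b
    using L by (simp add: frechet_derivative_works)
  have "(Y has_derivative frechet_derivative Y (at z)) (at z)"
    using Y by (simp add: frechet_derivative_works)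
  note D = has_derivative_linear_field[OF S lin L' this]
  show "frechet_derivative (\<lambda>u. L u (Y u)) (at z) v =
    frechet_derivative (\<lambda>u. L u (Y z)) (at z) v + L z (frechet_derivative Y (at z) v)" for v
    by (rule frechet_derivative_eqI[OF D])
  show "(\<lambda>u. L u (Y u)) differentiable (at z)"
    using D by (rule differentiableI)
qed

lemma frechet_derivative_bilinear_field:
  fixes G :: "'c::real_normed_vector \<Rightarrow> 'a::euclidean_space \<Rightarrow> 'b::euclidean_space \<Rightarrow> 'd::real_normed_vector"
  assumes S: "open S" "z \<in> S" and bil: "\<And>u. u \<in> S \<Longrightarrow> bilinear (G u)"
    and G: "\<And>a b. (\<lambda>u. G u a b) differentiable (at z)"
    and X: "X differentiable (at z)" and Y: "Y differentiable (at z)"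
  shows "frechet_derivative (\<lambda>u. G u (X u) (Y u)) (at z) v =
    frechet_derivative (\<lambda>u. G u (X z) (Y z)) (at z) v
    + G z (frechet_derivative X (at z) v) (Y z) + G z (X z) (frechet_derivative Y (at z) v)"
proof -
  have lin: "linear (G u a)" "linear (\<lambda>a. G u a b)" if "u \<in> S" for u a b
    using bil[OF that] by (auto simp: bilinear_def)
  note X_field = frechet_derivative_linear_field[OF S, where L="\<lambda>u a. G u a b" and Y=X for b, OF lin(2) G X]
  have "frechet_derivative (\<lambda>u. G u (X u) (Y u)) (at z) v
      = frechet_derivative (\<lambda>u. G u (X u) (Y z)) (at z) v + G z (X z) (frechet_derivative Y (at z) v)"
    by (rule frechet_derivative_linear_field(1)[OF S, where L="\<lambda>u. G u (X u)", OF lin(1) X_field(2) Y])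
  then show ?thesis by (simp add: X_field(1))
qed

section \<open>Symmetry of second derivatives\<close>

text \<open>
  The mean value theorem, used first along \<open>v\<close> and then along \<open>w\<close>. The left-hand side is
  symmetric in \<open>v\<close> and \<open>w\<close>, which forces equality of the mixed derivatives in the limit.
\<close>

lemma second_difference_mean_value:
  fixes f :: "'a::real_normed_vector \<Rightarrow> real"
  assumes f: "\<And>p. p \<in> ball x r \<Longrightarrow> f differentiable (at p)"
    and fv: "\<And>p. p \<in> ball x r \<Longrightarrow> (\<lambda>q. frechet_derivative f (at q) v) differentiable (at p)"
    and h: "0 < h" "h * (norm v + norm w) < r"
  shows "\<exists>p\<in>ball x r. f (x + h *\<^sub>R v + h *\<^sub>R w) - f (x + h *\<^sub>R v) - f (x + h *\<^sub>R w) + f x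
    = h * h * frechet_derivative (\<lambda>q. frechet_derivative f (at q) v) (at p) w"
proof -
  have in_ball: "x + s *\<^sub>R v + t *\<^sub>R w \<in> ball x r" if "0 \<le> s" "s \<le> h" "0 \<le> t" "t \<le> h" for s t
  proof -
    have "norm (s *\<^sub>R v + t *\<^sub>R w) \<le> s * norm v + t * norm w"
      using norm_triangle_ineq[of "s *\<^sub>R v" "t *\<^sub>R w"] that by simp
    also have "\<dots> \<le> h * norm v + h * norm w"
      using that by (intro add_mono mult_right_mono) auto
    finally show ?thesis using h by (simp add: dist_norm algebra_simps norm_minus_commute)
  qed
  have line: "((\<lambda>s. F (p + s *\<^sub>R d)) has_real_derivative frechet_derivative F (at (p + s *\<^sub>R d)) d) (at s)"
    if "F differentiable (at (p + s *\<^sub>R d))" for F :: "'a \<Rightarrow> real" and p d s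
  proof -
    have F: "(F has_derivative frechet_derivative F (at (p + s *\<^sub>R d))) (at (p + s *\<^sub>R d))"
      using that by (simp add: frechet_derivative_works)
    have "((\<lambda>s. F (p + s *\<^sub>R d)) has_derivative (\<lambda>k. frechet_derivative F (at (p + s *\<^sub>R d)) (k *\<^sub>R d))) (at s)"
      by (rule has_derivative_compose[where f="\<lambda>s. p + s *\<^sub>R d", OF _ F]) (auto intro!: derivative_eq_intros)
    moreover have "(\<lambda>k. frechet_derivative F (at (p + s *\<^sub>R d)) (k *\<^sub>R d)) = (*) (frechet_derivative F (at (p + s *\<^sub>R d)) d)"
      using has_derivative_linear[OF F] by (auto simp: linear_scale)
    ultimately show ?thesis by (simp add: has_field_derivative_def)
  qed
  let ?D = "\<lambda>q. frechet_derivative f (at q) v"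
  let ?u = "\<lambda>s. f (x + h *\<^sub>R w + s *\<^sub>R v) - f (x + s *\<^sub>R v)"
  have "\<exists>\<xi>. 0 < \<xi> \<and> \<xi> < h \<and> ?u h - ?u 0 = (h - 0) * (?D (x + h *\<^sub>R w + \<xi> *\<^sub>R v) - ?D (x + \<xi> *\<^sub>R v))"
  proof (rule MVT2[OF h(1)])
    fix s :: real assume s: "0 \<le> s" "s \<le> h"
    then show "(?u has_real_derivative ?D (x + h *\<^sub>R w + s *\<^sub>R v) - ?D (x + s *\<^sub>R v)) (at s)"
      using in_ball[of s h] in_ball[of s 0] h
      by (intro DERIV_diff line f) (auto simp: algebra_simps)
  qed
  then obtain \<xi> where \<xi>: "0 < \<xi>" "\<xi> < h" "?u h - ?u 0 = h * (?D (x + h *\<^sub>R w + \<xi> *\<^sub>R v) - ?D (x + \<xi> *\<^sub>R v))"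
    by auto
  have "\<exists>\<eta>. 0 < \<eta> \<and> \<eta> < h \<and> ?D (x + \<xi> *\<^sub>R v + h *\<^sub>R w) - ?D (x + \<xi> *\<^sub>R v + 0 *\<^sub>R w)
      = (h - 0) * frechet_derivative ?D (at (x + \<xi> *\<^sub>R v + \<eta> *\<^sub>R w)) w"
  proof (rule MVT2[OF h(1)])
    fix s :: real assume s: "0 \<le> s" "s \<le> h"
    then show "((\<lambda>s. ?D (x + \<xi> *\<^sub>R v + s *\<^sub>R w)) has_real_derivative
        frechet_derivative ?D (at (x + \<xi> *\<^sub>R v + s *\<^sub>R w)) w) (at s)"
      using in_ball[of \<xi> s] \<xi> by (intro line fv) auto
  qed
  then obtain \<eta> where \<eta>: "0 < \<eta>" "\<eta> < h" "?D (x + \<xi> *\<^sub>R v + h *\<^sub>R w) - ?D (x + \<xi> *\<^sub>R v)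
      = h * frechet_derivative ?D (at (x + \<xi> *\<^sub>R v + \<eta> *\<^sub>R w)) w"
    by auto
  have "x + \<xi> *\<^sub>R v + \<eta> *\<^sub>R w \<in> ball x r" using in_ball \<xi> \<eta> by auto
  moreover have "f (x + h *\<^sub>R v + h *\<^sub>R w) - f (x + h *\<^sub>R v) - f (x + h *\<^sub>R w) + f x = ?u h - ?u 0"
    by (simp add: algebra_simps)
  moreover have "?u h - ?u 0 = h * h * frechet_derivative ?D (at (x + \<xi> *\<^sub>R v + \<eta> *\<^sub>R w)) w"
    using \<xi>(3) \<eta>(3) by (simp add: algebra_simps)
  ultimately show ?thesis by metis
qed

lemma second_derivative_symmetric_real:
  fixes f :: "'a::real_normed_vector \<Rightarrow> real"
  assumes "open S" "smooth_on f S" "x \<in> S"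
  shows "frechet_derivative (\<lambda>q. frechet_derivative f (at q) v) (at x) w
       = frechet_derivative (\<lambda>q. frechet_derivative f (at q) w) (at x) v"
proof (rule ccontr)
  define H where "H = (\<lambda>v w p. frechet_derivative (\<lambda>q. frechet_derivative f (at q) v) (at p) w)"
  assume ne: "\<not> ?thesis"
  define \<epsilon> where "\<epsilon> = \<bar>H v w x - H w v x\<bar> / 2"
  have "\<epsilon> > 0" using ne by (simp add: \<epsilon>_def H_def)
  have cont: "continuous_on S (H v w)" for v w
    unfolding H_def
    by (intro smooth_on_imp_continuous_on smooth_on_frechet_derivative assms)
  obtain r where r: "r > 0" "ball x r \<subseteq> S"
    "\<And>p. p \<in> ball x r \<Longrightarrow> \<bar>H v w p - H v w x\<bar> < \<epsilon> \<and> \<bar>H w v p - H w v x\<bar> < \<epsilon>"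
  proof -
    define T where "T = (S \<inter> H v w -` ball (H v w x) \<epsilon>) \<inter> (S \<inter> H w v -` ball (H w v x) \<epsilon>)"
    have "open T"
      unfolding T_def by (intro open_Int continuous_open_preimage cont assms(1) open_ball)
    moreover have "x \<in> T" using assms(3) \<open>\<epsilon> > 0\<close> by (simp add: T_def)
    ultimately obtain d where d: "d > 0" "ball x d \<subseteq> T"
      by (meson open_contains_ball)
    have "p \<in> S \<and> \<bar>H v w p - H v w x\<bar> < \<epsilon> \<and> \<bar>H w v p - H w v x\<bar> < \<epsilon>" if "p \<in> ball x d" for p
      using subsetD[OF d(2) that] by (simp add: T_def dist_real_def abs_minus_commute)
    then show thesis using that d(1) by (metis subsetI)
  qed
  \<comment> \<open>Small enough for the whole parallelogram spanned by h v and h w to stay in the ball.\<close>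
  define h where "h = r / (2 * (norm v + norm w + 1))"
  have pos: "norm v + norm w + 1 > 0" by (simp add: add_nonneg_pos)
  have h: "h > 0" using r(1) pos by (simp add: h_def)
  have "h * (norm v + norm w) < r"
  proof -
    have "h * (norm v + norm w) \<le> h * (norm v + norm w + 1)" using h by simp
    also have "\<dots> = r / 2" using pos by (simp add: h_def field_simps)
    finally show ?thesis using r(1) by simp
  qed
  note hr = this
  have diff: "f differentiable (at p)" "(\<lambda>q. frechet_derivative f (at q) d) differentiable (at p)"
    if "p \<in> ball x r" for p d
    using smooth_on_differentiable[OF assms(2)] smooth_on_differentiable[OF smooth_on_frechet_derivative[OF assms(2)]]
      subsetD[OF r(2) that] by blast+
  obtain p where p: "p \<in> ball x r"
    "f (x + h *\<^sub>R v + h *\<^sub>R w) - f (x + h *\<^sub>R v) - f (x + h *\<^sub>R w) + f x = h * h * H v w p"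
    using second_difference_mean_value[where f=f and x=x and r=r and v=v and w=w and h=h] diff h hr
    unfolding H_def by metis
  obtain q where q: "q \<in> ball x r"
    "f (x + h *\<^sub>R w + h *\<^sub>R v) - f (x + h *\<^sub>R w) - f (x + h *\<^sub>R v) + f x = h * h * H w v q"
    using second_difference_mean_value[where f=f and x=x and r=r and v=w and w=v and h=h] diff h hr
    unfolding H_def by (metis add.commute)
  have "x + h *\<^sub>R w + h *\<^sub>R v = x + h *\<^sub>R v + h *\<^sub>R w" by simp
  then have "f (x + h *\<^sub>R w + h *\<^sub>R v) = f (x + h *\<^sub>R v + h *\<^sub>R w)" by (rule arg_cong)
  with p(2) q(2) have "h * h * H v w p = h * h * H w v q" by linarith
  then have "H v w p = H w v q" using h by simp
  then have "\<bar>H v w x - H w v x\<bar> < 2 * \<epsilon>"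
    using r(3)[OF p(1)] r(3)[OF q(1)] by linarith
  then show False by (simp add: \<epsilon>_def)
qed

lemma second_derivative_symmetric:
  fixes f :: "'a::real_normed_vector \<Rightarrow> 'b::euclidean_space"
  assumes "open S" "smooth_on f S" "x \<in> S"
  shows "frechet_derivative (\<lambda>q. frechet_derivative f (at q) v) (at x) w
       = frechet_derivative (\<lambda>q. frechet_derivative f (at q) w) (at x) v"
proof (rule euclidean_eqI)
  fix b :: 'b assume "b \<in> Basis"
  have comp: "frechet_derivative (\<lambda>q. F q \<bullet> b) (at p) d = frechet_derivative F (at p) d \<bullet> b"
    if "smooth_on F S" "p \<in> S" for F :: "'a \<Rightarrow> 'b" and p d
  proof -
    have "((\<lambda>q. F q \<bullet> b) has_derivative (\<lambda>d. frechet_derivative F (at p) d \<bullet> b)) (at p)"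
      using smooth_on_differentiable[OF that]
      by (intro has_derivative_inner_left) (simp add: frechet_derivative_works)
    then show ?thesis by (simp add: frechet_derivative_at[symmetric])
  qed
  have twice: "frechet_derivative (\<lambda>q. frechet_derivative (\<lambda>q. f q \<bullet> b) (at q) v) (at x) w
      = frechet_derivative (\<lambda>q. frechet_derivative f (at q) v) (at x) w \<bullet> b" for v w
  proof -
    have "frechet_derivative (\<lambda>q. frechet_derivative f (at q) v \<bullet> b) (at x) =
      frechet_derivative (\<lambda>q. frechet_derivative (\<lambda>q. f q \<bullet> b) (at q) v) (at x)"
      by (rule frechet_derivative_transform_within_open[OF _ assms(1,3)])
        (auto simp: comp[OF assms(2)] intro!: smooth_on_differentiable[OF _ assms(3)]
          smooth_on_bounded_linear[OF assms(1) bounded_linear_inner_left] smooth_on_frechet_derivative assms(2))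
    then show ?thesis
      using comp[OF smooth_on_frechet_derivative[OF assms(2)] assms(3), of v w] by simp
  qed
  show "frechet_derivative (\<lambda>q. frechet_derivative f (at q) v) (at x) w \<bullet> b
       = frechet_derivative (\<lambda>q. frechet_derivative f (at q) w) (at x) v \<bullet> b"
    using second_derivative_symmetric_real[OF assms(1)
        smooth_on_bounded_linear[OF assms(1) bounded_linear_inner_left assms(2)] assms(3), of b v w]
    by (simp add: twice)
qed

section \<open>Hermitian Jordan triple systems\<close>

locale positive_inner_product =
  fixes ip :: "'a::euclidean_space \<Rightarrow> 'a \<Rightarrow> real"
  assumes ip_bilinear: "bilinear ip"
    and ip_commute: "ip v w = ip w v"
    and ip_pos: "v \<noteq> 0 \<Longrightarrow> 0 < ip v v"
begin

lemmas ip_simps [simp] =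
  bilinear_ladd[OF ip_bilinear] bilinear_radd[OF ip_bilinear] bilinear_lmul[OF ip_bilinear]
  bilinear_rmul[OF ip_bilinear] bilinear_lneg[OF ip_bilinear] bilinear_rneg[OF ip_bilinear]
  bilinear_lsub[OF ip_bilinear] bilinear_rsub[OF ip_bilinear] bilinear_lzero[OF ip_bilinear]
  bilinear_rzero[OF ip_bilinear]

lemma ip_nonneg: "0 \<le> ip v v"
  using ip_pos[of v] by (cases "v = 0") auto

lemma ip_self_eq_0_iff [simp]: "ip v v = 0 \<longleftrightarrow> v = 0"
  using ip_pos[of v] by (cases "v = 0") auto

lemma ip_eqI:
  assumes "\<And>v. ip a v = ip b v" shows "a = b"
  using assms[of "a - b"] ip_self_eq_0_iff[of "a - b"] by simp

end

locale hermitian_jordan_triple = positive_inner_product ip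
  for ip :: "'a::euclidean_space \<Rightarrow> 'a \<Rightarrow> real" +
  fixes P :: "'a \<Rightarrow> 'a \<Rightarrow> 'a \<Rightarrow> 'a"
  assumes P_linear1: "linear (\<lambda>x. P x y w)"
    and P_linear2: "linear (\<lambda>y. P x y w)"
    and P_commute: "P x y w = P w y x"
    and P_adjoint: "ip (P x y u) v = ip u (P y x v)"
    and P_jordan: "P a b (P x y w) = P (P a b x) y w - P x (P b a y) w + P x y (P a b w)"
begin

lemma P_linear3: "linear (\<lambda>w. P x y w)"
  using P_linear1[of y x] by (simp add: P_commute[of x])

lemmas P_simps [simp] =
  linear_add[OF P_linear1] linear_scale[OF P_linear1] linear_neg[OF P_linear1] linear_diff[OF P_linear1]
  linear_0[OF P_linear1]
  linear_add[OF P_linear2] linear_scale[OF P_linear2] linear_neg[OF P_linear2] linear_diff[OF P_linear2]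
  linear_0[OF P_linear2]
  linear_add[OF P_linear3] linear_scale[OF P_linear3] linear_neg[OF P_linear3] linear_diff[OF P_linear3]
  linear_0[OF P_linear3]

text \<open>
  For the triple product of a Kaehler curvature tensor this is the holomorphic sectional curvature, not normalized.
\<close>

definition quartic :: "'a \<Rightarrow> real" where
  "quartic x = ip (P x x x) x"

lemma quartic_scale: "quartic (t *\<^sub>R x) = t ^ 4 * quartic x"
  by (simp add: quartic_def power4_eq_xxxx)

text \<open>
  Continuity of a trilinear map on the diagonal: expanding one argument in the basis leaves bilinear maps,
  which are continuous in finite dimension.
\<close>

lemma continuous_on_quartic: "continuous_on S quartic"
proof -
  have bil: "bilinear (P b)" for b
    by (simp add: bilinear_def P_linear2 P_linear3)
  have "P x x x = (\<Sum>b\<in>Basis. (x \<bullet> b) *\<^sub>R P b x x)" for x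
    by (rule linear_eq_sum_Basis[OF P_linear1])
  moreover have "continuous_on S (\<lambda>x. P b x x)" for b
    by (rule bilinear_continuous_on_compose[OF continuous_on_id continuous_on_id bil, simplified])
  ultimately have "continuous_on S (\<lambda>x. P x x x)"
    by (simp add: continuous_on_sum continuous_on_scaleR continuous_on_inner)
  then show ?thesis
    unfolding quartic_def[abs_def]
    by (rule bilinear_continuous_on_compose[OF _ continuous_on_id ip_bilinear, simplified])
qed

text \<open>
  Only the coefficients of \<open>t\<^sup>0\<close> and \<open>t\<^sup>1\<close> matter. The four first-order terms
  agree by the symmetries of \<open>P\<close>.
\<close>

lemma quartic_expand:
  "quartic (e + t *\<^sub>R v) = quartic e + t * (4 * ip (P e e e) v)
    + t^2 * (4 * ip (P e e v) v + ip (P e v e) v + ip (P v e v) e)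
    + t^3 * (4 * ip (P v v v) e) + t^4 * quartic v"
proof -
  have "ip (P e e v) e = ip (P e e e) v" "ip (P v e e) e = ip (P e e e) v" "ip (P e v e) e = ip (P e e e) v"
    "ip (P v v e) v = ip (P v v v) e" "ip (P e v v) v = ip (P v v v) e" "ip (P v e v) v = ip (P v v v) e"
    "ip (P v e e) v = ip (P e e v) v" "ip (P e v v) e = ip (P e e v) v" "ip (P v v e) e = ip (P e e v) v"
    by (metis P_adjoint P_commute ip_commute)+
  then show ?thesis
    by (simp add: quartic_def algebra_simps power2_eq_square power3_eq_cube power4_eq_xxxx)
qed

text \<open>
  The first-order condition at a maximum of the ratio \<open>s * quartic x / (ip x x)\<^sup>2\<close>. The sign \<open>s\<close> treats
  maxima and minima together. The case \<open>c = 0\<close>, where the quartic form vanishes identically and every point is critical,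
  shows that all cubes vanish.
\<close>

lemma quartic_critical:
  assumes le: "\<And>x. s * quartic x \<le> c * (ip x x)\<^sup>2" and eq: "s * quartic e = c * (ip e e)\<^sup>2"
  shows "s *\<^sub>R P e e e = (c * ip e e) *\<^sub>R e"
proof (rule ip_eqI)
  fix v
  define \<phi> where "\<phi> t = s * quartic (e + t *\<^sub>R v) - c * (ip (e + t *\<^sub>R v) (e + t *\<^sub>R v))\<^sup>2" for t
  have \<phi>: "\<phi> = (\<lambda>t. s * (quartic e + t * (4 * ip (P e e e) v)
    + t^2 * (4 * ip (P e e v) v + ip (P e v e) v + ip (P v e v) e)
    + t^3 * (4 * ip (P v v v) e) + t^4 * quartic v) - c * (ip e e + t * (2 * ip e v) + t^2 * ip v v)\<^sup>2)"
    by (rule ext) (simp add: \<phi>_def quartic_expand ip_commute[of v e] algebra_simps power2_eq_square)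
  have "(\<phi> has_real_derivative s * (4 * ip (P e e e) v) - c * (4 * ip e e * ip e v)) (at 0)"
    unfolding \<phi> by (auto intro!: derivative_eq_intros simp: algebra_simps)
  moreover have "\<phi> t \<le> \<phi> 0" for t
    using le[of "e + t *\<^sub>R v"] eq by (simp add: \<phi>_def)
  ultimately have "s * (4 * ip (P e e e) v) - c * (4 * ip e e * ip e v) = 0"
    by (metis DERIV_local_max zero_less_one)
  then show "ip (s *\<^sub>R P e e e) v = ip ((c * ip e e) *\<^sub>R e) v"
    by simp
qed

text \<open>
  The function \<open>\<rho>\<close> is invariant under scaling, so its maximum on the compact unit sphere is a global one, and
  \<open>quartic_critical\<close> applies at that point.
\<close>

lemma exists_tripotent:
  assumes "P x x x \<noteq> 0"
  shows "\<exists>e l. e \<noteq> 0 \<and> l \<noteq> 0 \<and> P e e e = l *\<^sub>R e"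
proof -
  define \<rho> where "\<rho> x = \<bar>quartic x\<bar> / (ip x x)\<^sup>2" for x
  have "continuous_on (sphere 0 1) (\<lambda>x. ip x x)"
    by (rule bilinear_continuous_on_compose[OF continuous_on_id continuous_on_id ip_bilinear, simplified])
  then have cont: "continuous_on (sphere 0 1) \<rho>"
    unfolding \<rho>_def[abs_def]
    by (intro continuous_intros continuous_on_quartic) auto
  obtain e where e: "norm e = 1" "\<And>x. norm x = 1 \<Longrightarrow> \<rho> x \<le> \<rho> e"
    using continuous_attains_sup[OF compact_sphere _ cont] by (auto simp: sphere_def) (use norm_Basis SOME_Basis in blast)
  have "e \<noteq> 0" using e(1) by auto
  then have pos: "ip e e > 0" by (rule ip_pos)
  have max: "\<bar>quartic x\<bar> \<le> \<rho> e * (ip x x)\<^sup>2" for x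
  proof (cases "x = 0")
    case True
    then show ?thesis by (simp add: quartic_def)
  next
    case False
    define y where "y = (1 / norm x) *\<^sub>R x"
    have "norm y = 1" using False by (simp add: y_def)
    have "\<rho> x = \<rho> y"
      using False by (simp add: y_def \<rho>_def quartic_scale abs_mult power2_eq_square power4_eq_xxxx)
    then have "\<rho> x \<le> \<rho> e" using e(2)[OF \<open>norm y = 1\<close>] by simp
    moreover have "\<bar>quartic x\<bar> = \<rho> x * (ip x x)\<^sup>2" using False by (simp add: \<rho>_def)
    ultimately show ?thesis by (simp add: mult_right_mono)
  qed
  have \<rho>e: "\<bar>quartic e\<bar> = \<rho> e * (ip e e)\<^sup>2" using \<open>e \<noteq> 0\<close> by (simp add: \<rho>_def)
  have "\<rho> e \<noteq> 0"
  proof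
    assume "\<rho> e = 0"
    then have "quartic y = 0" for y using max[of y] by simp
    then have "1 *\<^sub>R P x x x = (0 * ip x x) *\<^sub>R x" by (intro quartic_critical) auto
    with assms show False by simp
  qed
  \<comment> \<open>Maxima and minima of the quartic form: the sign of its value at e.\<close>
  define s :: real where "s = (if quartic e \<ge> 0 then 1 else -1)"
  have "s *\<^sub>R P e e e = (\<rho> e * ip e e) *\<^sub>R e"
    by (rule quartic_critical) (use max \<rho>e in \<open>auto simp: s_def abs_le_iff split: if_splits\<close>)
  then have "s *\<^sub>R s *\<^sub>R P e e e = (s * (\<rho> e * ip e e)) *\<^sub>R e" by simp
  moreover have "s * s = 1" by (simp add: s_def)
  ultimately have "P e e e = (s * (\<rho> e * ip e e)) *\<^sub>R e" by simp
  moreover have "s * (\<rho> e * ip e e) \<noteq> 0" using \<open>\<rho> e \<noteq> 0\<close> pos by (auto simp: s_def)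
  ultimately show ?thesis using \<open>e \<noteq> 0\<close> by blast
qed

text \<open>
  The Peirce relation \<open>A (2 A - l) (A - l) = 0\<close> for \<open>A = P e e\<close>. With \<open>Q y = P e y e\<close>, three instances of the Jordan
  identity give \<open>A Q = 2 l Q - Q A\<close>, \<open>l Q = 2 A Q - Q A\<close> and \<open>Q\<^sup>2 = 2 A\<^sup>2 - l A\<close>. The first two imply
  \<open>A Q = l Q\<close>, so \<open>A - l\<close> kills \<open>Q\<^sup>2\<close>.
\<close>

lemma peirce_polynomial:
  assumes e: "P e e e = l *\<^sub>R e"
  shows "2 *\<^sub>R P e e (P e e (P e e y)) = (3 * l) *\<^sub>R P e e (P e e y) - l\<^sup>2 *\<^sub>R P e e y"
proof -
  define A where "A = P e e"
  define Q where "Q y = P e y e" for y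
  have AQ: "A (Q y) = l *\<^sub>R Q y + l *\<^sub>R Q y - Q (A y)" for y
    using P_jordan[of e e e y e] by (simp add: A_def Q_def e)
  have lQ: "l *\<^sub>R Q y = 2 *\<^sub>R A (Q y) - Q (A y)" for y
    using P_jordan[of e y e e e] P_commute[of "Q y" e e] P_commute[of y e e]
    by (simp add: A_def Q_def e algebra_simps scaleR_2)
  have AQ': "A (Q y) = l *\<^sub>R Q y" for y
  proof (rule ip_eqI)
    fix v
    have "3 * ip (A (Q y)) v = 3 * (l * ip (Q y) v)"
      using arg_cong[OF AQ[of y], of "\<lambda>a. ip a v"] arg_cong[OF lQ[of y], of "\<lambda>a. ip a v"] by simp
    then show "ip (A (Q y)) v = ip (l *\<^sub>R Q y) v" by simp
  qed
  have QQ: "Q (Q y) = 2 *\<^sub>R A (A y) - l *\<^sub>R A y" for y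
    using P_jordan[of y e e e e] P_commute[of y e e] P_commute[of "P e e y" e e]
    by (simp add: A_def Q_def e algebra_simps scaleR_2)
  have "A (2 *\<^sub>R A (A y) - l *\<^sub>R A y) = l *\<^sub>R (2 *\<^sub>R A (A y) - l *\<^sub>R A y)"
    using AQ'[of "Q y"] by (simp only: QQ)
  then have "2 *\<^sub>R A (A (A y)) = (3 * l) *\<^sub>R A (A y) - l\<^sup>2 *\<^sub>R A y"
    by (simp add: A_def algebra_simps power2_eq_square flip: scaleR_add_left)
  then show ?thesis by (simp add: A_def)
qed

text \<open>
  On the eigenvalues \<open>0\<close>, \<open>l/2\<close>, \<open>l\<close> of \<open>A\<close>, the polynomials \<open>l\<^sup>2 (l A - A\<^sup>2)\<close> and \<open>4 (l A - A\<^sup>2)\<^sup>2\<close>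
  coincide, so they coincide as operators, and the second one is non-negative. This replaces the diagonalization of \<open>A\<close>.
\<close>

lemma peirce_form_ge:
  assumes e: "P e e e = l *\<^sub>R e" and "l \<noteq> 0"
  shows "ip (P e e y) (P e e y) \<le> l * ip (P e e y) y"
proof -
  define A where "A = P e e"
  have [simp]: "A (a + b) = A a + A b" "A (a - b) = A a - A b" "A (t *\<^sub>R a) = t *\<^sub>R A a" for a b t
    by (simp_all add: A_def)
  have adj: "ip (A a) b = ip a (A b)" for a b by (simp add: A_def P_adjoint)
  have poly: "2 *\<^sub>R A (A (A a)) = (3 * l) *\<^sub>R A (A a) - l\<^sup>2 *\<^sub>R A a" for a
    unfolding A_def by (rule peirce_polynomial[OF e])
  have p: "2 * ip (A (A (A a))) b = 3 * l * ip (A (A a)) b - l\<^sup>2 * ip (A a) b" for a b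
    using arg_cong[OF poly[of a], of "\<lambda>v. ip v b"] by simp
  define d where "d = l *\<^sub>R A y - A (A y)"
  have "ip d d = l\<^sup>2 * ip (A (A y)) y - 2 * l * ip (A (A (A y))) y + ip (A (A (A (A y)))) y"
    by (simp add: d_def adj[symmetric] algebra_simps power2_eq_square)
  moreover have "2 * ip (A (A (A (A y)))) y = 3 * l * ip (A (A (A y))) y - l\<^sup>2 * ip (A (A y)) y"
    using p[of "A y" y] .
  moreover note p[of y y]
  ultimately have "4 * ip d d = l\<^sup>2 * (l * ip (A y) y - ip (A (A y)) y)"
    by algebra
  then have "0 \<le> l\<^sup>2 * (l * ip (A y) y - ip (A (A y)) y)"
    using ip_nonneg[of d] by linarith
  then have "0 \<le> l * ip (A y) y - ip (A (A y)) y"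
    using \<open>l \<noteq> 0\<close> by (simp add: zero_le_mult_iff)
  moreover have "ip (A (A y)) y = ip (A y) (A y)" by (rule adj)
  ultimately show ?thesis by (simp add: A_def)
qed

text \<open>
  Polarizing \<open>P x x x = 0\<close> gives \<open>2 P x x y + P x y x = 0\<close>. Replacing \<open>y\<close> by \<open>I y\<close> changes the relative
  sign of the two terms, because \<open>P\<close> is antilinear in the middle argument only; hence both vanish. The same device finishes
  the proof.
\<close>

lemma triple_zero_if_cubes_zero:
  assumes cube: "\<And>x. P x x x = 0"
    and I: "\<And>v. I (I v) = - v" "linear I"
    and PI: "\<And>x y w. P (I x) y w = I (P x y w)" "\<And>x y w. P x (I y) w = - I (P x y w)"
  shows "P x y w = 0"
proof -
  have I_cancel: "v = 0" if "I v = 0" for v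
    using I(1)[of v] that linear_0[OF I(2)] by simp
  have pol: "2 *\<^sub>R P x x y + P x y x = 0" for x y
  proof (rule ip_eqI)
    fix v
    have "ip (P (x + y) (x + y) (x + y)) v - ip (P (x - y) (x - y) (x - y)) v
      = 4 * ip (P x x y) v + 2 * ip (P x y x) v + 2 * ip (P y y y) v"
      by (simp add: P_commute[of y x x] P_commute[of y y x] del: bilinear_lsub)
    then show "ip (2 *\<^sub>R P x x y + P x y x) v = ip 0 v"
      by (simp only: cube) simp
  qed
  have "I (2 *\<^sub>R P x x y - P x y x) = 0" for x y
    using pol[of x "I y"] P_commute[of x x "I y"] P_commute[of x x y]
    by (simp add: PI linear_diff[OF I(2)] linear_scale[OF I(2)])
  then have eq: "P x y x = 2 *\<^sub>R P x x y" for x y using I_cancel by (metis eq_iff_diff_eq_0)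
  have xx: "P x x y = 0" for x y
    using pol[of x y] unfolding eq by (simp flip: scaleR_add_left)
  have "P (x + y) (x + y) w = P x x w + (P x y w + P y x w) + P y y w" for x y w
    by simp
  then have "P x y w + P y x w = 0" for x y w
    by (simp only: xx) simp
  then have anti: "P x y w = - P y x w" for x y w
    by (simp only: eq_neg_iff_add_eq_0)
  have "I (P x y w) = I (P y x w)"
    using anti[of "I x" y w] by (simp add: PI)
  then have "I (P x y w - P y x w) = 0" by (simp add: linear_diff[OF I(2)])
  then have "P x y w = P y x w" using I_cancel by force
  with anti[of x y w] show ?thesis by (metis scaleR_2 add.right_inverse scaleR_eq_0_iff zero_neq_numeral)
qed

end

section \<open>Unitary frames\<close>

lemma J_simps:
  fixes v w :: "complex ^ 'n"
  shows "J (v + w) = J v + J w" "J (v - w) = J v - J w" "J (- v) = - J v"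
    "J (r *\<^sub>R v) = r *\<^sub>R J v" "J (J v) = - v" "J 0 = 0"
  by (simp_all add: vec_eq_iff algebra_simps)

lemma linear_J: "linear (J :: complex ^ 'n \<Rightarrow> complex ^ 'n)"
  by (rule linearI) (simp_all add: J_simps)

locale hermitian_inner_product = positive_inner_product ip
  for ip :: "complex ^ 'n::finite \<Rightarrow> complex ^ 'n \<Rightarrow> real" +
  assumes ip_J: "ip (J v) (J w) = ip v w"
begin

lemma ip_J_left: "ip (J v) w = - ip v (J w)"
  using ip_J[of v "J w"] by (simp add: J_simps)

lemma ip_J_self: "ip v (J v) = 0"
  using ip_J_left[of v v] by (simp add: ip_commute[of "J v" v])

text \<open>
  A real vector \<open>a\<close> stands for the (1,0) vector \<open>a - \<i> J a\<close>, whose Hermitian norm squared is \<open>2 (ip a a)\<close>. The value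
  \<open>1/2\<close> therefore makes these (1,0) vectors a unitary system.
\<close>

definition orthogonal_system :: "(complex ^ 'n) set \<Rightarrow> bool" where
  "orthogonal_system S \<longleftrightarrow>
     (\<forall>s\<in>S. \<forall>t\<in>S. ip s t = (if s = t then 1/2 else 0) \<and> ip s (J t) = 0)"

lemma orthogonal_system_normalize:
  assumes "u \<noteq> 0"
  shows "\<exists>r. r \<noteq> 0 \<and> ip (r *\<^sub>R u) (r *\<^sub>R u) = 1/2"
proof (intro exI conjI)
  have "ip u u > 0" using assms by (rule ip_pos)
  then show "1 / sqrt (2 * ip u u) \<noteq> 0"
    "ip ((1 / sqrt (2 * ip u u)) *\<^sub>R u) ((1 / sqrt (2 * ip u u)) *\<^sub>R u) = 1/2"
    by (auto simp: real_sqrt_mult_self field_simps)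
qed

text \<open>
  A Gram-Schmidt step. The complex span of fewer than \<open>CARD('n)\<close> vectors is not everything, and subtracting the projections
  to all \<open>s\<close> and \<open>J s\<close> from a vector outside leaves a non-zero vector. The coefficients carry a factor 2 because \<open>ip s s = 1/2\<close>.
\<close>

lemma orthogonal_system_extend:
  assumes S: "finite S" "orthogonal_system S" and card: "card S < CARD('n)"
  shows "\<exists>u. u \<notin> S \<and> orthogonal_system (insert u S)"
proof -
  have "vec.span S \<noteq> UNIV"
  proof
    assume "vec.span S = UNIV"
    then have "vec.dim (UNIV :: (complex ^ 'n) set) \<le> card S"
      by (intro vec.dim_le_card S) simp
    with card show False by (simp add: vec_dim_card card_cart_basis)
  qed
  then obtain v where v: "v \<notin> vec.span S" by blast
  define u where "u = v - (\<Sum>s\<in>S. (2 * ip v s) *\<^sub>R s + (2 * ip v (J s)) *\<^sub>R J s)"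
  have span_scaleR: "r *\<^sub>R x \<in> vec.span S" if "x \<in> vec.span S" for r x
  proof -
    have "r *\<^sub>R x = complex_of_real r *s x" by (simp add: vec_eq_iff scaleR_conv_of_real[of r "x $ i" for i])
    then show ?thesis using vec.span_scale[OF that] by simp
  qed
  have "u \<noteq> 0"
  proof
    assume "u = 0"
    then have "v = (\<Sum>s\<in>S. (2 * ip v s) *\<^sub>R s + (2 * ip v (J s)) *\<^sub>R J s)" by (simp add: u_def)
    also have "\<dots> \<in> vec.span S"
      by (intro vec.span_sum vec.span_add span_scaleR vec.span_scale vec.span_base)
    finally show False using v by simp
  qed
  have sum_left: "ip (\<Sum>s\<in>S. h s) w = (\<Sum>s\<in>S. ip (h s) w)" for h w
    using ip_bilinear by (simp add: bilinear_def linear_sum[where f="\<lambda>x. ip x w"])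
  have orth: "ip u t = 0" "ip u (J t) = 0" if "t \<in> S" for t
  proof -
    have "ip s t = (if s = t then 1/2 else 0)" "ip s (J t) = 0" "ip (J s) t = 0"
      "ip (J s) (J t) = (if s = t then 1/2 else 0)" if "s \<in> S" for s
      using S(2) that \<open>t \<in> S\<close> by (auto simp: orthogonal_system_def ip_J ip_J_left)
    then have "(\<Sum>s\<in>S. ip ((2 * ip v s) *\<^sub>R s + (2 * ip v (J s)) *\<^sub>R J s) t) = (\<Sum>s\<in>S. if s = t then ip v s else 0)"
      "(\<Sum>s\<in>S. ip ((2 * ip v s) *\<^sub>R s + (2 * ip v (J s)) *\<^sub>R J s) (J t)) = (\<Sum>s\<in>S. if s = t then ip v (J s) else 0)"
      by (auto intro!: sum.cong)
    then show "ip u t = 0" "ip u (J t) = 0"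
      using that S(1) by (simp_all add: u_def sum_left)
  qed
  obtain r where r: "r \<noteq> 0" "ip (r *\<^sub>R u) (r *\<^sub>R u) = 1/2"
    using orthogonal_system_normalize[OF \<open>u \<noteq> 0\<close>] by blast
  have o: "ip (r *\<^sub>R u) t = 0" "ip t (r *\<^sub>R u) = 0" "ip (r *\<^sub>R u) (J t) = 0" "ip t (J (r *\<^sub>R u)) = 0" if "t \<in> S" for t
    using orth[OF that] ip_J_left[of t u] ip_commute[of t u] ip_commute[of "J t" u] by (simp_all add: J_simps)
  have "r *\<^sub>R u \<notin> S" using o(1) r(2) by force
  moreover have "orthogonal_system (insert (r *\<^sub>R u) S)"
    using S(2) o r(2) \<open>r *\<^sub>R u \<notin> S\<close> ip_J_self
    unfolding orthogonal_system_def by (auto simp del: ip_simps)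
  ultimately show ?thesis by blast
qed

text \<open>
  The frame is indexed by the same type as the coordinates, and one of its members is a multiple of a given vector: this makes one
  term of a trace visibly non-zero.
\<close>

lemma exists_unitary_frame:
  assumes "e \<noteq> 0"
  shows "\<exists>a :: 'n \<Rightarrow> complex ^ 'n. (\<exists>i r. r \<noteq> 0 \<and> a i = r *\<^sub>R e) \<and>
    (\<forall>j k. ip (a j) (a k) = (if j = k then 1/2 else 0) \<and> ip (a j) (J (a k)) = 0)"
proof -
  obtain r where r: "r \<noteq> 0" "ip (r *\<^sub>R e) (r *\<^sub>R e) = 1/2"
    using orthogonal_system_normalize[OF assms] by blast
  have "\<exists>S. finite S \<and> card S = Suc k \<and> r *\<^sub>R e \<in> S \<and> orthogonal_system S" if "Suc k \<le> CARD('n)" for k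
    using that
  proof (induction k)
    case 0
    show ?case
      by (intro exI[of _ "{r *\<^sub>R e}"]) (use r(2) ip_J_self in \<open>auto simp: orthogonal_system_def simp del: ip_simps\<close>)
  next
    case (Suc k)
    then obtain S where S: "finite S" "card S = Suc k" "r *\<^sub>R e \<in> S" "orthogonal_system S" by auto
    then obtain u where "u \<notin> S" "orthogonal_system (insert u S)"
      using orthogonal_system_extend[of S] Suc.prems by auto
    with S show ?case by (intro exI[of _ "insert u S"]) auto
  qed
  from this[of "CARD('n) - 1"] obtain S where
    S: "finite S" "card S = CARD('n)" "r *\<^sub>R e \<in> S" "orthogonal_system S" by auto
  then obtain a :: "'n \<Rightarrow> complex ^ 'n" where a: "bij_betw a UNIV S"
    using finite_same_card_bij[of "UNIV :: 'n set" S] by auto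
  then obtain i where "a i = r *\<^sub>R e" using S(3) by (metis bij_betw_imp_surj_on imageE)
  moreover have "a j \<in> S" "a j = a k \<longleftrightarrow> j = k" for j k
    using a by (auto simp: bij_betw_def inj_eq)
  then have "\<forall>j k. ip (a j) (a k) = (if j = k then 1/2 else 0) \<and> ip (a j) (J (a k)) = 0"
    using S(4) by (simp add: orthogonal_system_def)
  ultimately show ?thesis using r(1) by blast
qed

end

section \<open>Kaehler-like curvature tensors at a point\<close>

text \<open>
  \<open>K_metric\<close> and \<open>K_J\<close> reflect that the connection is metric and complex. \<open>K_JJ\<close> and
  \<open>K_exchange\<close> are the real forms of the two Kaehler-like conditions, and \<open>K_derivation\<close> is what parallel
  curvature leaves behind at one point, \<open>K(a, b) \<cdot> K = 0\<close>.
\<close>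

locale kaehler_like_curvature = hermitian_inner_product ip
  for ip :: "complex ^ 'n::finite \<Rightarrow> complex ^ 'n \<Rightarrow> real" +
  fixes K :: "complex ^ 'n \<Rightarrow> complex ^ 'n \<Rightarrow> complex ^ 'n \<Rightarrow> complex ^ 'n"
  assumes K_linear: "linear (\<lambda>a. K a b w)" "linear (\<lambda>b. K a b w)" "linear (\<lambda>w. K a b w)"
    and K_skew: "K b a w = - K a b w"
    and K_metric: "ip (K a b c) d = - ip c (K a b d)"
    and K_J: "K a b (J w) = J (K a b w)"
    and K_JJ: "K (J a) (J b) w = K a b w"
    and K_exchange: "K a b c + J (K a (J b) c) = K c b a + J (K c (J b) a)"
    and K_derivation: "K a b (K x y w) = K (K a b x) y w + K x (K a b y) w + K x y (K a b w)"
begin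

text \<open>
  The curvature operator \<open>K(X, conj Y)\<close> for the (1,0) vectors \<open>X = (a - \<i> J a) / 2\<close> and \<open>Y = (b - \<i> J b) / 2\<close>,
  transported to real vectors by identifying the complex unit with \<open>J\<close> on vectors of type (1,0).
\<close>

definition P :: "complex ^ 'n \<Rightarrow> complex ^ 'n \<Rightarrow> complex ^ 'n \<Rightarrow> complex ^ 'n" where
  "P a b w = (1/2) *\<^sub>R (K a b w + J (K a (J b) w))"

lemmas K_simps = linear_add[OF K_linear(1)] linear_scale[OF K_linear(1)] linear_neg[OF K_linear(1)] linear_diff[OF K_linear(1)]
  linear_add[OF K_linear(2)] linear_scale[OF K_linear(2)] linear_neg[OF K_linear(2)] linear_diff[OF K_linear(2)]
  linear_add[OF K_linear(3)] linear_scale[OF K_linear(3)] linear_neg[OF K_linear(3)] linear_diff[OF K_linear(3)]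

lemma K_J_left: "K (J a) b w = - K a (J b) w"
  using K_JJ[of a "J b" w] by (simp add: J_simps K_simps) (metis minus_minus)

lemma P_J: "P (J x) y w = J (P x y w)" "P x (J y) w = - J (P x y w)"
  by (simp_all add: P_def K_J_left K_JJ J_simps K_simps algebra_simps)

text \<open>
  The Jordan identity is a combination of the derivation property for the four pairs formed from \<open>b\<close>, \<open>J b\<close> and \<open>y\<close>, \<open>J y\<close>,
  with coefficients dictated by complex linearity. The minus sign in it comes from \<open>- P b a = (K(a, b) - J K(a, J b)) / 2\<close>.
\<close>

sublocale hermitian_jordan_triple ip P
proof (rule hermitian_jordan_triple.intro[OF positive_inner_product_axioms], rule hermitian_jordan_triple_axioms.intro)
  show "linear (\<lambda>x. P x y w)" for y w
    by (rule linearI) (simp_all add: P_def K_simps J_simps algebra_simps)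
  show "linear (\<lambda>y. P x y w)" for x w
    by (rule linearI) (simp_all add: P_def K_simps J_simps algebra_simps)
  show "P x y w = P w y x" for x y w
    by (simp add: P_def K_exchange)
  show "ip (P x y u) v = ip u (P y x v)" for x y u v
    using K_metric[of x y u v] K_metric[of x "J y" u "J v"] K_skew[of y x v] K_skew[of y "J x" v] ip_J_left[of _ v]
    by (simp add: P_def K_J_left K_J ip_J_left)
  show "P a b (P x y w) = P (P a b x) y w - P x (P b a y) w + P x y (P a b w)" for a b x y w
  proof (rule ip_eqI)
    fix v
    have ba: "K b a y = - K a b y" "K b (J a) y = K a (J b) y"
      using K_skew[of b a y] K_skew[of b "J a" y] by (simp_all add: K_J_left)
    note d = arg_cong[OF K_derivation[of a b x y w], of "\<lambda>u. ip u v"]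
      arg_cong[OF K_derivation[of a b x "J y" w], of "\<lambda>u. ip u (J v)"]
      arg_cong[OF K_derivation[of a "J b" x y w], of "\<lambda>u. ip u (J v)"]
      arg_cong[OF K_derivation[of a "J b" x "J y" w], of "\<lambda>u. ip u v"]
    show "ip (P a b (P x y w)) v = ip (P (P a b x) y w - P x (P b a y) w + P x y (P a b w)) v"
      using d by (simp add: P_def ba K_simps J_simps K_J K_JJ K_J_left ip_J_left algebra_simps)
  qed
qed

text \<open>
  The Ricci hypothesis says that the operators \<open>P x x\<close> have trace zero. At a tripotent \<open>e\<close> with eigenvalue \<open>l\<close>, every diagonal
  entry of \<open>l * P e e\<close> is non-negative by \<open>peirce_form_ge\<close>, and the one that belongs to \<open>e\<close> itself is positive.
\<close>

theorem ricci_flat_imp_zero: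
  assumes ricci: "\<And>x (a :: 'n \<Rightarrow> complex ^ 'n).
    (\<And>j k. ip (a j) (a k) = (if j = k then 1/2 else 0)) \<Longrightarrow> (\<And>j k. ip (a j) (J (a k)) = 0) \<Longrightarrow>
    (\<Sum>i\<in>UNIV. ip (K x (J x) (a i)) (J (a i))) = 0"
  shows "K x y w = 0"
proof -
  have cubes: "P x x x = 0" for x
  proof (rule ccontr)
    assume "P x x x \<noteq> 0"
    then obtain e l where e: "e \<noteq> 0" "l \<noteq> 0" "P e e e = l *\<^sub>R e"
      using exists_tripotent by blast
    obtain a :: "'n \<Rightarrow> complex ^ 'n" where a_e: "\<exists>i r. r \<noteq> 0 \<and> a i = r *\<^sub>R e" and a_frame:
      "\<forall>j k. ip (a j) (a k) = (if j = k then 1/2 else 0) \<and> ip (a j) (J (a k)) = 0"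
      using exists_unitary_frame[OF e(1)] by (elim exE) (erule conjE, rule that)
    obtain i r where a: "r \<noteq> 0" "a i = r *\<^sub>R e"
      using a_e by (elim exE conjE)
    have frame: "ip (a j) (a k) = (if j = k then 1/2 else 0)" "ip (a j) (J (a k)) = 0" for j k
      using a_frame by (simp_all only:)
    have "2 *\<^sub>R K e e w = 0" for w
      by (subst scaleR_2, subst (2) K_skew) (rule add.right_inverse)
    then have Kee: "K e e w = 0" for w by simp
    have "ip (P e e v) v = - (1/2) * ip (K e (J e) v) (J v)" for v
      using ip_J_left[of "K e (J e) v" v] by (simp only: P_def Kee add_0_left bilinear_lmul[OF ip_bilinear]) simp
    then have "(\<Sum>j\<in>UNIV. l * ip (P e e (a j)) (a j)) = - (l/2) * (\<Sum>j\<in>UNIV. ip (K e (J e) (a j)) (J (a j)))"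
      by (simp add: sum_distrib_left)
    also have "\<dots> = 0" using ricci[OF frame] by simp
    finally have sum0: "(\<Sum>j\<in>UNIV. l * ip (P e e (a j)) (a j)) = 0" .
    have ge: "ip (P e e (a j)) (P e e (a j)) \<le> l * ip (P e e (a j)) (a j)" for j
      by (rule peirce_form_ge[OF e(3,2)])
    have "0 < ip (P e e (a i)) (P e e (a i))"
      by (rule ip_pos) (use a e in simp)
    also have "\<dots> \<le> (\<Sum>j\<in>UNIV. ip (P e e (a j)) (P e e (a j)))"
      by (rule member_le_sum) (simp_all add: ip_nonneg)
    also have "\<dots> \<le> (\<Sum>j\<in>UNIV. l * ip (P e e (a j)) (a j))"
      by (rule sum_mono) (rule ge)
    finally show False using sum0 by simp
  qed
  have "P x y w = 0" for x y w
    by (rule triple_zero_if_cubes_zero[where I=J, OF cubes _ linear_J]) (simp_all add: J_simps P_J)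
  then have "P x y w - P y x w = 0" by simp
  moreover have "P x y w - P y x w = K x y w"
    using K_skew[of y x w] K_J_left[of x y w] K_skew[of y "J x" w]
    by (simp add: P_def K_J_left scaleR_2[symmetric] flip: scaleR_diff_right)
  ultimately show ?thesis by simp
qed

end

section \<open>Curvature of a connection in a chart\<close>

locale connection_chart =
  fixes U :: "(complex ^ 'n::finite) set" and \<Gamma> :: "'n christoffel"
  assumes open_U: "open U"
    and \<Gamma>_smooth: "smooth_on (\<lambda>z. \<Gamma> z v w) U"
    and \<Gamma>_bilinear: "z \<in> U \<Longrightarrow> bilinear (\<Gamma> z)"
begin

lemmas \<Gamma>_simps =
  bilinear_ladd[OF \<Gamma>_bilinear] bilinear_radd[OF \<Gamma>_bilinear] bilinear_lmul[OF \<Gamma>_bilinear]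
  bilinear_rmul[OF \<Gamma>_bilinear] bilinear_lsub[OF \<Gamma>_bilinear] bilinear_rsub[OF \<Gamma>_bilinear]
  bilinear_lzero[OF \<Gamma>_bilinear] bilinear_rzero[OF \<Gamma>_bilinear]

lemma linear_frechet_derivative_smooth:
  "smooth_on f U \<Longrightarrow> z \<in> U \<Longrightarrow> linear (frechet_derivative f (at z))"
  using smooth_on_differentiable by (blast intro: linear_frechet_derivative)

lemma smooth_on_cov:
  assumes "smooth_on X U" "smooth_on Y U"
  shows "smooth_on (cov \<Gamma> X Y) U"
  unfolding cov_def
proof (rule smooth_on_add[OF open_U])
  show "smooth_on (\<lambda>z. frechet_derivative Y (at z) (X z)) U"
    by (rule smooth_on_linear_field[where L="\<lambda>z. frechet_derivative Y (at z)", OF open_U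
          linear_frechet_derivative_smooth[OF assms(2)] smooth_on_frechet_derivative[OF assms(2)] assms(1)])
  show "smooth_on (\<lambda>z. \<Gamma> z (X z) (Y z)) U"
    by (rule smooth_on_bilinear_field[OF open_U \<Gamma>_bilinear \<Gamma>_smooth assms])
qed

lemma smooth_on_lie_bracket:
  assumes "smooth_on X U" "smooth_on Y U"
  shows "smooth_on (lie_bracket X Y) U"
  unfolding lie_bracket_def
  by (rule smooth_on_diff[OF open_U];
      rule smooth_on_linear_field[OF open_U linear_frechet_derivative_smooth smooth_on_frechet_derivative])
    (simp_all add: assms)

lemma smooth_on_curvature:
  assumes "smooth_on X U" "smooth_on Y U" "smooth_on Z U"
  shows "smooth_on (curvature \<Gamma> X Y Z) U"
  unfolding curvature_def
  using smooth_on_cov smooth_on_lie_bracket assms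
  by (intro smooth_on_diff open_U) auto

text \<open>
  The curvature tensor at a point, obtained from fields that are constant in the chart.
\<close>

definition R :: "complex ^ 'n \<Rightarrow> complex ^ 'n \<Rightarrow> complex ^ 'n \<Rightarrow> complex ^ 'n \<Rightarrow> complex ^ 'n" where
  "R z a b w = curvature \<Gamma> (\<lambda>_. a) (\<lambda>_. b) (\<lambda>_. w) z"

lemma frechet_derivative_cov:
  assumes z: "z \<in> U" and Y: "smooth_on Y U" and Z: "smooth_on Z U"
  shows "frechet_derivative (cov \<Gamma> Y Z) (at z) v =
      frechet_derivative (\<lambda>u. frechet_derivative Z (at u) (Y z)) (at z) v
    + frechet_derivative Z (at z) (frechet_derivative Y (at z) v)
    + frechet_derivative (\<lambda>u. \<Gamma> u (Y z) (Z z)) (at z) v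
    + \<Gamma> z (frechet_derivative Y (at z) v) (Z z) + \<Gamma> z (Y z) (frechet_derivative Z (at z) v)"
proof -
  have dY: "Y differentiable (at z)" and dZ: "Z differentiable (at z)"
    and dG: "(\<lambda>u. \<Gamma> u a b) differentiable (at z)" for a b
    using smooth_on_differentiable[OF _ z] Y Z \<Gamma>_smooth by blast+
  have dDZ: "(\<lambda>u. frechet_derivative Z (at u) b) differentiable (at z)" for b
    using smooth_on_differentiable[OF smooth_on_frechet_derivative[OF Z] z] .
  have d1: "(\<lambda>u. frechet_derivative Z (at u) (Y u)) differentiable (at z)"
    by (rule frechet_derivative_linear_field(2)[where L="\<lambda>u. frechet_derivative Z (at u)", OF open_U z
          linear_frechet_derivative_smooth[OF Z] dDZ dY])
  have d2: "(\<lambda>u. \<Gamma> u (Y u) (Z u)) differentiable (at z)"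
    using smooth_on_differentiable[OF smooth_on_bilinear_field[OF open_U \<Gamma>_bilinear \<Gamma>_smooth Y Z] z] .
  have "frechet_derivative (cov \<Gamma> Y Z) (at z) v = frechet_derivative (\<lambda>u. frechet_derivative Z (at u) (Y u)) (at z) v
    + frechet_derivative (\<lambda>u. \<Gamma> u (Y u) (Z u)) (at z) v"
    unfolding cov_def
    by (rule frechet_derivative_eqI, rule has_derivative_add)
      (use d1 d2 in \<open>simp_all add: frechet_derivative_works\<close>)
  also have "frechet_derivative (\<lambda>u. frechet_derivative Z (at u) (Y u)) (at z) v =
      frechet_derivative (\<lambda>u. frechet_derivative Z (at u) (Y z)) (at z) v
    + frechet_derivative Z (at z) (frechet_derivative Y (at z) v)"
    by (rule frechet_derivative_linear_field(1)[where L="\<lambda>u. frechet_derivative Z (at u)", OF open_U z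
          linear_frechet_derivative_smooth[OF Z] dDZ dY])
  also have "frechet_derivative (\<lambda>u. \<Gamma> u (Y u) (Z u)) (at z) v =
      frechet_derivative (\<lambda>u. \<Gamma> u (Y z) (Z z)) (at z) v
    + \<Gamma> z (frechet_derivative Y (at z) v) (Z z) + \<Gamma> z (Y z) (frechet_derivative Z (at z) v)"
    by (rule frechet_derivative_bilinear_field[OF open_U z \<Gamma>_bilinear dG dY dZ])
  finally show ?thesis by (simp add: algebra_simps)
qed

text \<open>
  The coordinate expression of the curvature. All terms with derivatives of \<open>X\<close>, \<open>Y\<close>, \<open>Z\<close> cancel against the bracket term, except the second
  derivatives of \<open>Z\<close>, which cancel by symmetry.
\<close>

lemma curvature_formula:
  assumes z: "z \<in> U" and X: "smooth_on X U" and Y: "smooth_on Y U" and Z: "smooth_on Z U"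
  shows "curvature \<Gamma> X Y Z z =
      frechet_derivative (\<lambda>u. \<Gamma> u (Y z) (Z z)) (at z) (X z)
    - frechet_derivative (\<lambda>u. \<Gamma> u (X z) (Z z)) (at z) (Y z)
    + \<Gamma> z (X z) (\<Gamma> z (Y z) (Z z)) - \<Gamma> z (Y z) (\<Gamma> z (X z) (Z z))"
proof -
  have "cov \<Gamma> X (cov \<Gamma> Y Z) z = frechet_derivative (cov \<Gamma> Y Z) (at z) (X z)
      + \<Gamma> z (X z) (frechet_derivative Z (at z) (Y z)) + \<Gamma> z (X z) (\<Gamma> z (Y z) (Z z))" for X Y
    using z by (simp add: cov_def[of \<Gamma> X] \<Gamma>_simps) (simp add: cov_def \<Gamma>_simps)
  moreover have "cov \<Gamma> (lie_bracket X Y) Z z =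
      frechet_derivative Z (at z) (frechet_derivative Y (at z) (X z))
    - frechet_derivative Z (at z) (frechet_derivative X (at z) (Y z))
    + \<Gamma> z (frechet_derivative Y (at z) (X z)) (Z z) - \<Gamma> z (frechet_derivative X (at z) (Y z)) (Z z)"
    using z linear_diff[OF linear_frechet_derivative_smooth[OF Z z]]
    by (simp add: cov_def lie_bracket_def \<Gamma>_simps)
  moreover note second_derivative_symmetric[OF open_U Z z, of "X z" "Y z"]
  ultimately show ?thesis
    by (simp add: curvature_def frechet_derivative_cov[OF z X Z] frechet_derivative_cov[OF z Y Z])
qed

lemma curvature_tensorial:
  assumes z: "z \<in> U" and X: "smooth_on X U" and Y: "smooth_on Y U" and Z: "smooth_on Z U"
  shows "curvature \<Gamma> X Y Z z = R z (X z) (Y z) (Z z)"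
  unfolding R_def curvature_formula[OF assms] curvature_formula[OF z smooth_on_const smooth_on_const smooth_on_const] ..

lemma cov_cong:
  assumes "z \<in> U" "smooth_on F U" "\<And>u. u \<in> U \<Longrightarrow> F u = G u"
  shows "cov \<Gamma> V F z = cov \<Gamma> V G z"
  using frechet_derivative_transform_within_open[OF smooth_on_differentiable[OF assms(2,1)] open_U assms(1,3)]
    assms(1,3) by (simp add: cov_def)

text \<open>
  Coordinate fields commute, so the bracket term disappears.
\<close>

lemma R_commutator:
  assumes z: "z \<in> U" and F: "smooth_on F U"
  shows "R z a b (F z) = cov \<Gamma> (\<lambda>_. a) (cov \<Gamma> (\<lambda>_. b) F) z - cov \<Gamma> (\<lambda>_. b) (cov \<Gamma> (\<lambda>_. a) F) z"
proof -
  have "cov \<Gamma> (lie_bracket (\<lambda>_. a) (\<lambda>_. b)) F z = 0"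
    using linear_0[OF linear_frechet_derivative_smooth[OF F z]] z
    by (simp add: cov_def lie_bracket_def \<Gamma>_simps)
  then show ?thesis
    using curvature_tensorial[OF z smooth_on_const smooth_on_const F, of a b] by (simp add: curvature_def)
qed

lemma R_skew: "z \<in> U \<Longrightarrow> R z b a w = - R z a b w"
  using R_commutator[OF _ smooth_on_const, of z] by simp

lemma R_linear:
  assumes z: "z \<in> U"
  shows "linear (\<lambda>a. R z a b w)" "linear (\<lambda>b. R z a b w)" "linear (\<lambda>w. R z a b w)"
proof -
  have R: "R z a b w = frechet_derivative (\<lambda>u. \<Gamma> u b w) (at z) a - frechet_derivative (\<lambda>u. \<Gamma> u a w) (at z) b
    + \<Gamma> z a (\<Gamma> z b w) - \<Gamma> z b (\<Gamma> z a w)" for a b w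
    unfolding R_def by (rule curvature_formula[OF z smooth_on_const smooth_on_const smooth_on_const])
  have D: "(\<lambda>u. \<Gamma> u b w) differentiable (at z)" for b w
    using smooth_on_differentiable[OF \<Gamma>_smooth z] .
  have transform: "frechet_derivative (\<lambda>u. \<Gamma> u b w) (at z) v = F' v"
    if "\<And>u. u \<in> U \<Longrightarrow> F u = \<Gamma> u b w" "(F has_derivative F') (at z)" for b w v F F'
    using has_derivative_transform_within_open[OF that(2) open_U z that(1)]
    by (rule frechet_derivative_eqI)
  have [simp]: "frechet_derivative (\<lambda>u. \<Gamma> u (b + b') w) (at z) v =
      frechet_derivative (\<lambda>u. \<Gamma> u b w) (at z) v + frechet_derivative (\<lambda>u. \<Gamma> u b' w) (at z) v"
    "frechet_derivative (\<lambda>u. \<Gamma> u b (w + w')) (at z) v =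
      frechet_derivative (\<lambda>u. \<Gamma> u b w) (at z) v + frechet_derivative (\<lambda>u. \<Gamma> u b w') (at z) v"
    "frechet_derivative (\<lambda>u. \<Gamma> u (r *\<^sub>R b) w) (at z) v = r *\<^sub>R frechet_derivative (\<lambda>u. \<Gamma> u b w) (at z) v"
    "frechet_derivative (\<lambda>u. \<Gamma> u b (r *\<^sub>R w)) (at z) v = r *\<^sub>R frechet_derivative (\<lambda>u. \<Gamma> u b w) (at z) v"
    for b b' w w' v r
    by (rule transform[where F="\<lambda>u. \<Gamma> u b w + \<Gamma> u b' w"] transform[where F="\<lambda>u. \<Gamma> u b w + \<Gamma> u b w'"]
         transform[where F="\<lambda>u. r *\<^sub>R \<Gamma> u b w"];
       use D in \<open>auto simp: \<Gamma>_simps frechet_derivative_works intro!: has_derivative_add has_derivative_scaleR_right\<close>)+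
  have [simp]: "frechet_derivative (\<lambda>u. \<Gamma> u b w) (at z) (v + v') =
      frechet_derivative (\<lambda>u. \<Gamma> u b w) (at z) v + frechet_derivative (\<lambda>u. \<Gamma> u b w) (at z) v'"
    "frechet_derivative (\<lambda>u. \<Gamma> u b w) (at z) (r *\<^sub>R v) = r *\<^sub>R frechet_derivative (\<lambda>u. \<Gamma> u b w) (at z) v"
    for b w v v' r
    using linear_frechet_derivative[OF D] by (simp_all add: linear_add linear_scale)
  show "linear (\<lambda>a. R z a b w)" "linear (\<lambda>b. R z a b w)" "linear (\<lambda>w. R z a b w)"
    by (rule linearI; simp add: R \<Gamma>_simps[OF z] algebra_simps)+
qed

text \<open>
  Differentiating \<open>curvature X Y Z\<close> twice by the Leibniz rule for a parallel tensor and taking the commutator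
  leaves only the terms in which both derivatives fall on the same factor; the mixed ones are symmetric in the two directions.
\<close>

lemma R_derivation_of_parallel:
  assumes par: "\<And>W X Y Z z. smooth_on W U \<Longrightarrow> smooth_on X U \<Longrightarrow> smooth_on Y U \<Longrightarrow> smooth_on Z U \<Longrightarrow> z \<in> U \<Longrightarrow>
      cov \<Gamma> W (curvature \<Gamma> X Y Z) z = curvature \<Gamma> (cov \<Gamma> W X) Y Z z
        + curvature \<Gamma> X (cov \<Gamma> W Y) Z z + curvature \<Gamma> X Y (cov \<Gamma> W Z) z"
    and z: "z \<in> U"
  shows "R z a b (R z x y w) = R z (R z a b x) y w + R z x (R z a b y) w + R z x y (R z a b w)"
proof -
  define A B X Y Z :: "'n vfield" where [abs_def]: "A u = a" "B u = b" "X u = x" "Y u = y" "Z u = w" for u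
  note sm = smooth_on_cov smooth_on_curvature
  have c [simp]: "smooth_on A U" "smooth_on B U" "smooth_on X U" "smooth_on Y U" "smooth_on Z U"
    by (simp_all add: A_B_X_Y_Z_def smooth_on_const)
  have cov_add: "cov \<Gamma> V (\<lambda>u. F u + G u + H u) z = cov \<Gamma> V F z + cov \<Gamma> V G z + cov \<Gamma> V H z"
    if "smooth_on F U" "smooth_on G U" "smooth_on H U" for V F G H
  proof -
    have "frechet_derivative (\<lambda>u. F u + G u + H u) (at z) v = frechet_derivative F (at z) v
      + frechet_derivative G (at z) v + frechet_derivative H (at z) v" for v
      by (rule frechet_derivative_eqI, intro has_derivative_add)
        (use smooth_on_differentiable[OF _ z] that in \<open>auto simp: frechet_derivative_works\<close>)
    then show ?thesis by (simp add: cov_def \<Gamma>_simps[OF z])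
  qed
  have second: "cov \<Gamma> V (cov \<Gamma> W (curvature \<Gamma> X Y Z)) z =
      curvature \<Gamma> (cov \<Gamma> V (cov \<Gamma> W X)) Y Z z + curvature \<Gamma> (cov \<Gamma> W X) (cov \<Gamma> V Y) Z z
        + curvature \<Gamma> (cov \<Gamma> W X) Y (cov \<Gamma> V Z) z
    + (curvature \<Gamma> (cov \<Gamma> V X) (cov \<Gamma> W Y) Z z + curvature \<Gamma> X (cov \<Gamma> V (cov \<Gamma> W Y)) Z z
        + curvature \<Gamma> X (cov \<Gamma> W Y) (cov \<Gamma> V Z) z)
    + (curvature \<Gamma> (cov \<Gamma> V X) Y (cov \<Gamma> W Z) z + curvature \<Gamma> X (cov \<Gamma> V Y) (cov \<Gamma> W Z) z
        + curvature \<Gamma> X Y (cov \<Gamma> V (cov \<Gamma> W Z)) z)"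
    if [simp]: "smooth_on V U" "smooth_on W U" for V W
  proof -
    have "cov \<Gamma> V (cov \<Gamma> W (curvature \<Gamma> X Y Z)) z = cov \<Gamma> V (\<lambda>u. curvature \<Gamma> (cov \<Gamma> W X) Y Z u
        + curvature \<Gamma> X (cov \<Gamma> W Y) Z u + curvature \<Gamma> X Y (cov \<Gamma> W Z) u) z"
      by (rule cov_cong[OF z]) (simp_all add: sm par)
    then show ?thesis by (simp add: cov_add sm par z)
  qed
  have Rval: "R z a b (F z) = cov \<Gamma> A (cov \<Gamma> B F) z - cov \<Gamma> B (cov \<Gamma> A F) z" if "smooth_on F U" for F
    using R_commutator[OF z that] by (simp add: A_B_X_Y_Z_def)
  have "R z a b (R z x y w) = R z a b (curvature \<Gamma> X Y Z z)"
    by (simp add: R_def A_B_X_Y_Z_def)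
  also have "\<dots> = cov \<Gamma> A (cov \<Gamma> B (curvature \<Gamma> X Y Z)) z - cov \<Gamma> B (cov \<Gamma> A (curvature \<Gamma> X Y Z)) z"
    by (rule Rval) (simp add: sm)
  also have "\<dots> = R z (cov \<Gamma> A (cov \<Gamma> B X) z) (Y z) (Z z) - R z (cov \<Gamma> B (cov \<Gamma> A X) z) (Y z) (Z z)
      + (R z (X z) (cov \<Gamma> A (cov \<Gamma> B Y) z) (Z z) - R z (X z) (cov \<Gamma> B (cov \<Gamma> A Y) z) (Z z))
      + (R z (X z) (Y z) (cov \<Gamma> A (cov \<Gamma> B Z) z) - R z (X z) (Y z) (cov \<Gamma> B (cov \<Gamma> A Z) z))"
    by (simp add: second curvature_tensorial[OF z] sm)
  also have "\<dots> = R z (R z a b (X z)) (Y z) (Z z) + R z (X z) (R z a b (Y z)) (Z z) + R z (X z) (Y z) (R z a b (Z z))"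
    by (simp only: Rval c linear_diff[OF R_linear(1)[OF z]] linear_diff[OF R_linear(2)[OF z]] linear_diff[OF R_linear(3)[OF z]])
  finally show ?thesis by (simp add: A_B_X_Y_Z_def)
qed

end

section \<open>Curvature of a Hermitian connection\<close>

locale hermitian_connection_chart = connection_chart U \<Gamma>
  for U :: "(complex ^ 'n::finite) set" and \<Gamma> :: "'n christoffel" +
  fixes g :: "'n chart_form"
  assumes g_smooth: "smooth_on (\<lambda>z. g z v w) U"
    and g_inner: "z \<in> U \<Longrightarrow> hermitian_inner_product (g z)"
    and metric: "smooth_on X U \<Longrightarrow> smooth_on Y U \<Longrightarrow> smooth_on Z U \<Longrightarrow> z \<in> U \<Longrightarrow>
      frechet_derivative (\<lambda>u. g u (Y u) (Z u)) (at z) (X z) =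
        g z (cov \<Gamma> X Y z) (Z z) + g z (Y z) (cov \<Gamma> X Z z)"
    and cov_J: "smooth_on X U \<Longrightarrow> smooth_on Y U \<Longrightarrow> z \<in> U \<Longrightarrow>
      cov \<Gamma> X (\<lambda>u. J (Y u)) z = J (cov \<Gamma> X Y z)"
begin

text \<open>
  The second derivatives of \<open>g(c, d)\<close> are computed from the compatibility of \<open>g\<close> with the connection and antisymmetrized. The
  products of first covariant derivatives are symmetric and drop out.
\<close>

lemma R_metric:
  assumes z: "z \<in> U"
  shows "g z (R z a b c) d = - g z c (R z a b d)"
proof -
  interpret hermitian_inner_product "g z" using z by (rule g_inner)
  have gbil: "bilinear (g u)" if "u \<in> U" for u
    using g_inner[OF that] by (simp add: hermitian_inner_product_def positive_inner_product_def)
  let ?D = "\<lambda>a. cov \<Gamma> (\<lambda>_. a)"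
  have second: "frechet_derivative (\<lambda>u. frechet_derivative (\<lambda>u. g u c d) (at u) b) (at z) a =
      g z (?D a (?D b (\<lambda>_. c)) z) d + g z (?D b (\<lambda>_. c) z) (?D a (\<lambda>_. d) z)
    + (g z (?D a (\<lambda>_. c) z) (?D b (\<lambda>_. d) z) + g z c (?D a (?D b (\<lambda>_. d)) z))" for a b
  proof -
    let ?F = "\<lambda>u. g u (?D b (\<lambda>_. c) u) d" and ?G = "\<lambda>u. g u c (?D b (\<lambda>_. d) u)"
    have sm: "smooth_on (?D b (\<lambda>_. w)) U" for w
      by (intro smooth_on_cov smooth_on_const)
    have "smooth_on ?F U"
      by (rule smooth_on_bilinear_field[OF open_U gbil g_smooth sm smooth_on_const])
    moreover have "smooth_on ?G U"
      by (rule smooth_on_bilinear_field[OF open_U gbil g_smooth smooth_on_const sm])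
    ultimately have dF: "?F differentiable (at z)" and dG: "?G differentiable (at z)"
      using z by (blast intro: smooth_on_differentiable)+
    have "frechet_derivative (\<lambda>u. ?F u + ?G u) (at z) =
        frechet_derivative (\<lambda>u. frechet_derivative (\<lambda>u. g u c d) (at u) b) (at z)"
    proof (rule frechet_derivative_transform_within_open[OF _ open_U z])
      show "(\<lambda>u. ?F u + ?G u) differentiable (at z)"
        by (rule differentiable_add[OF dF dG])
      show "?F u + ?G u = frechet_derivative (\<lambda>u. g u c d) (at u) b" if "u \<in> U" for u
        by (rule metric[where X="\<lambda>_. b" and Y="\<lambda>_. c" and Z="\<lambda>_. d", OF smooth_on_const smooth_on_const smooth_on_const that, symmetric])
    qed
    then have "frechet_derivative (\<lambda>u. frechet_derivative (\<lambda>u. g u c d) (at u) b) (at z) a =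
        frechet_derivative (\<lambda>u. ?F u + ?G u) (at z) a" by (rule fun_cong[OF sym])
    also have "\<dots> = frechet_derivative ?F (at z) a + frechet_derivative ?G (at z) a"
      by (rule frechet_derivative_eqI, rule has_derivative_add)
        (use dF dG in \<open>simp_all add: frechet_derivative_works\<close>)
    also have "frechet_derivative ?F (at z) a = g z (?D a (?D b (\<lambda>_. c)) z) d + g z (?D b (\<lambda>_. c) z) (?D a (\<lambda>_. d) z)"
      by (rule metric[where X="\<lambda>_. a" and Y="?D b (\<lambda>_. c)" and Z="\<lambda>_. d", OF smooth_on_const sm smooth_on_const z])
    also have "frechet_derivative ?G (at z) a = g z (?D a (\<lambda>_. c) z) (?D b (\<lambda>_. d) z) + g z c (?D a (?D b (\<lambda>_. d)) z)"
      by (rule metric[where X="\<lambda>_. a" and Y="\<lambda>_. c" and Z="?D b (\<lambda>_. d)", OF smooth_on_const smooth_on_const sm z])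
    finally show ?thesis .
  qed
  have "R z a b w = ?D a (?D b (\<lambda>_. w)) z - ?D b (?D a (\<lambda>_. w)) z" for w
    using R_commutator[OF z smooth_on_const[of w]] .
  then have "g z (R z a b c) d + g z c (R z a b d) =
      g z (?D a (?D b (\<lambda>_. c)) z) d - g z (?D b (?D a (\<lambda>_. c)) z) d
      + (g z c (?D a (?D b (\<lambda>_. d)) z) - g z c (?D b (?D a (\<lambda>_. d)) z))"
    by (simp only: bilinear_lsub[OF ip_bilinear] bilinear_rsub[OF ip_bilinear])
  with second[of b a] second[of a b] second_derivative_symmetric[OF open_U g_smooth z, of c d a b]
  show ?thesis by linarith
qed

lemma R_J:
  assumes z: "z \<in> U"
  shows "R z a b (J w) = J (R z a b w)"
proof -
  have twice: "cov \<Gamma> (\<lambda>_. a) (cov \<Gamma> (\<lambda>_. b) (\<lambda>_. J w)) z = J (cov \<Gamma> (\<lambda>_. a) (cov \<Gamma> (\<lambda>_. b) (\<lambda>_. w)) z)" for a b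
  proof -
    have "cov \<Gamma> (\<lambda>_. a) (cov \<Gamma> (\<lambda>_. b) (\<lambda>_. J w)) z = cov \<Gamma> (\<lambda>_. a) (\<lambda>u. J (cov \<Gamma> (\<lambda>_. b) (\<lambda>_. w) u)) z"
      by (rule cov_cong[OF z]) (simp_all add: smooth_on_cov smooth_on_const cov_J[where Y="\<lambda>_. w"])
    also have "\<dots> = J (cov \<Gamma> (\<lambda>_. a) (cov \<Gamma> (\<lambda>_. b) (\<lambda>_. w)) z)"
      by (intro cov_J smooth_on_cov smooth_on_const z)
    finally show ?thesis .
  qed
  show ?thesis
    using R_commutator[OF z smooth_on_const[of "J w"], of a b] R_commutator[OF z smooth_on_const[of w], of a b]
    by (simp add: twice J_simps)
qed

lemma curvature4_eq: "curvature4 g \<Gamma> z a b c d = g z (R z a b c) d"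
  by (simp add: curvature4_def R_def)

text \<open>
  The formal imaginary unit and the factors of the pairs are expanded into the sixteen real curvature terms, which
  \<open>R_J\<close> and the \<open>J\<close>-invariance of the metric group into four. The real parts suffice, since \<open>d\<close> is arbitrary and the imaginary part is
  the real part for another \<open>d\<close>.
\<close>

lemma curvatureC_20:
  assumes z: "z \<in> U"
  shows "Re (curvatureC g \<Gamma> z (a, - J a) (b, - J b) (c, - J c) (conj_vec (d, - J d))) =
    2 * (g z (R z a b c) d - g z (R z (J a) (J b) c) d + g z (R z (J a) b c) (J d) + g z (R z a (J b) c) (J d))"
proof -
  interpret hermitian_inner_product "g z" using z by (rule g_inner)
  show ?thesis
    by (simp add: curvatureC_def cext_def conj_vec_def curvature4_eq R_J[OF z] ip_J ip_J_left
        linear_neg[OF R_linear(1)[OF z]] linear_neg[OF R_linear(2)[OF z]] linear_neg[OF R_linear(3)[OF z]])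
qed

lemma curvatureC_11:
  assumes z: "z \<in> U"
  shows "Re (curvatureC g \<Gamma> z (a, - J a) (conj_vec (b, - J b)) (c, - J c) (conj_vec (d, - J d))) =
    2 * (g z (R z a b c) d + g z (R z (J a) (J b) c) d + g z (R z (J a) b c) (J d) - g z (R z a (J b) c) (J d))"
proof -
  interpret hermitian_inner_product "g z" using z by (rule g_inner)
  show ?thesis
    by (simp add: curvatureC_def cext_def conj_vec_def curvature4_eq R_J[OF z] ip_J ip_J_left
        linear_neg[OF R_linear(1)[OF z]] linear_neg[OF R_linear(2)[OF z]] linear_neg[OF R_linear(3)[OF z]])
qed

lemma curvatureC_trace_term:
  assumes z: "z \<in> U"
  shows "Im (curvatureC g \<Gamma> z (x, 0) (y, 0) (c, - J c) (conj_vec (c, - J c))) = 2 * g z (R z x y c) (J c)"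
proof -
  interpret hermitian_inner_product "g z" using z by (rule g_inner)
  show ?thesis
    by (simp add: curvatureC_def cext_def conj_vec_def curvature4_eq R_J[OF z] ip_J ip_J_left
        linear_0[OF R_linear(1)[OF z]] linear_0[OF R_linear(2)[OF z]] linear_neg[OF R_linear(3)[OF z]])
qed

end

lemma type_10_iff: "type_10 v \<longleftrightarrow> snd v = - J (fst v)"
proof
  assume "type_10 v"
  then have "J (fst v) = - snd v" by (simp add: type_10_def)
  then show "snd v = - J (fst v)" by (simp only: minus_minus)
next
  assume "snd v = - J (fst v)"
  then show "type_10 v" by (simp add: type_10_def J_simps)
qed

context hermitian_connection_chart
begin

text \<open>
  The (2,0) part of the curvature gives one complex equation in \<open>a\<close> and \<open>b\<close>. Exchanging \<open>c\<close> and \<open>d\<close>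
  reverses the sign of one half of its terms and preserves the other half, so it splits and yields \<open>R(J a, J b) = R(a, b)\<close>. With this
  the second Kaehler-like condition becomes the exchange symmetry.
\<close>

lemma kaehler_like_curvature_R:
  assumes z: "z \<in> U"
    and par: "\<And>W X Y Z z. smooth_on W U \<Longrightarrow> smooth_on X U \<Longrightarrow> smooth_on Y U \<Longrightarrow> smooth_on Z U \<Longrightarrow> z \<in> U \<Longrightarrow>
      cov \<Gamma> W (curvature \<Gamma> X Y Z) z = curvature \<Gamma> (cov \<Gamma> W X) Y Z z
        + curvature \<Gamma> X (cov \<Gamma> W Y) Z z + curvature \<Gamma> X Y (cov \<Gamma> W Z) z"
    and kl: "\<And>x y u v. type_10 x \<Longrightarrow> type_10 y \<Longrightarrow> type_10 u \<Longrightarrow> type_10 v \<Longrightarrow>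
      curvatureC g \<Gamma> z x y u (conj_vec v) = 0 \<and>
      curvatureC g \<Gamma> z x (conj_vec y) u (conj_vec v) = curvatureC g \<Gamma> z u (conj_vec y) x (conj_vec v)"
  shows "kaehler_like_curvature (g z) (R z)"
proof -
  interpret hermitian_inner_product "g z" using z by (rule g_inner)
  have t: "type_10 (a, - J a)" for a :: "complex ^ 'n"
    by (simp add: type_10_iff)
  have kl20: "g z (R z a b c) d - g z (R z (J a) (J b) c) d + g z (R z (J a) b c) (J d) + g z (R z a (J b) c) (J d) = 0"
    for a b c d
    using curvatureC_20[OF z, of a b c d] kl[OF t t t t, of a b c d] by simp
  have swap: "g z (R z a b d) c = - g z (R z a b c) d" "g z (R z a b d) (J c) = g z (R z a b c) (J d)" for a b c d
    using R_metric[OF z, of a b d c] R_metric[OF z, of a b d "J c"]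
    by (simp_all add: ip_commute[of d] R_J[OF z] ip_J_left)
  have JJ: "R z (J a) (J b) w = R z a b w" for a b w
  proof (rule ip_eqI)
    fix d
    show "g z (R z (J a) (J b) w) d = g z (R z a b w) d"
      using kl20[of a b w d] kl20[of a b d w] by (simp add: swap[of _ _ d w])
  qed
  have J_left: "R z (J a) b w = - R z a (J b) w" for a b w
    using JJ[of a "J b" w] by (simp add: J_simps linear_neg[OF R_linear(2)[OF z]]) (metis minus_minus)
  have exchange: "R z a b c + J (R z a (J b) c) = R z c b a + J (R z c (J b) a)" for a b c
  proof (rule ip_eqI)
    fix d
    have Re_11: "Re (curvatureC g \<Gamma> z (a, - J a) (conj_vec (b, - J b)) (c, - J c) (conj_vec (d, - J d)))
      = 4 * g z (R z a b c + J (R z a (J b) c)) d" for a c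
      by (simp add: curvatureC_11[OF z] JJ J_left ip_J_left J_simps linear_neg[OF R_linear(2)[OF z]])
    have "4 * g z (R z a b c + J (R z a (J b) c)) d = 4 * g z (R z c b a + J (R z c (J b) a)) d"
      unfolding Re_11[symmetric] using kl[OF t t t t, of a b c d] by (simp only:)
    then show "g z (R z a b c + J (R z a (J b) c)) d = g z (R z c b a + J (R z c (J b) a)) d"
      by (simp only: mult_cancel_left) simp
  qed
  show ?thesis
  proof (rule kaehler_like_curvature.intro[OF hermitian_inner_product_axioms], rule kaehler_like_curvature_axioms.intro)
    show "R z a b (R z x y w) = R z (R z a b x) y w + R z x (R z a b y) w + R z x y (R z a b w)" for a b x y w
      by (rule R_derivation_of_parallel[OF par z])
  qed (rule R_linear[OF z] R_skew[OF z] R_metric[OF z] R_J[OF z] JJ exchange)+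
qed

text \<open>
  For arguments \<open>x\<close>, \<open>y\<close> without imaginary part, the \<open>i\<close>-th summand of the first Ricci form is
  \<open>2 \<i> g(R(x, y) a\<^sub>i, J a\<^sub>i)\<close>.
\<close>

lemma first_ricci_real:
  fixes a :: "'n \<Rightarrow> complex ^ 'n"
  assumes z: "z \<in> U"
    and frame: "\<And>j k. g z (a j) (a k) = (if j = k then 1/2 else 0)" "\<And>j k. g z (a j) (J (a k)) = 0"
    and ricci: "\<And>e x y. unitary_frame g z e \<Longrightarrow> first_ricci g \<Gamma> z e x y = 0"
  shows "(\<Sum>i\<in>UNIV. g z (R z x y (a i)) (J (a i))) = 0"
proof -
  interpret hermitian_inner_product "g z" using z by (rule g_inner)
  have "unitary_frame g z (\<lambda>i. (a i, - J (a i)))"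
    by (simp add: unitary_frame_def type_10_iff metricC_def cext_def conj_vec_def frame ip_J ip_J_left complex_eq_iff)
  from ricci[OF this] have "Im (first_ricci g \<Gamma> z (\<lambda>i. (a i, - J (a i))) (x, 0) (y, 0)) = 0"
    by simp
  then show ?thesis
    by (simp add: first_ricci_def curvatureC_trace_term[OF z] sum_distrib_left[symmetric])
qed

end

section \<open>Vanishing of the Bismut curvature\<close>

theorem proposition1p8:
  fixes M :: "'a topology"
    and A :: "('a, 'n::finite) chart set"
    and g :: "('a, 'n) chart \<Rightarrow> 'n chart_form"
    and \<Gamma> :: "('a, 'n) chart \<Rightarrow> 'n christoffel"
  assumes "complex_manifold M A"
    and "hermitian_metric A g"
    and "complete_metric M A g"
    and "bismut_connection A g \<Gamma>"
    and "ambrose_singer A \<Gamma>"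
    and "first_ricci_vanishes A g \<Gamma>"
    and "kaehler_like A g \<Gamma>"
  shows "flat_connection A \<Gamma>"
  unfolding flat_connection_def
proof (intro ballI allI impI, elim conjE)
  fix c and X Y Z :: "'n vfield" and z
  assume c: "c \<in> A" and sm: "smooth_on X (chart_image c)" "smooth_on Y (chart_image c)" "smooth_on Z (chart_image c)"
    and z: "z \<in> chart_image c"
  have chart: "connection_chart (chart_image c) (\<Gamma> c)"
    using assms(1,4) c
    by (simp add: connection_chart_def complex_manifold_def bismut_connection_def affine_connection_def)
  have inner: "hermitian_inner_product (g c z)" if "z \<in> chart_image c" for z
    using assms(2) c that
    by (simp add: hermitian_inner_product_def hermitian_inner_product_axioms_def positive_inner_product_def hermitian_metric_def)
  interpret hermitian_connection_chart "chart_image c" "\<Gamma> c" "g c"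
  proof (intro hermitian_connection_chart.intro hermitian_connection_chart_axioms.intro chart inner)
    show "smooth_on (\<lambda>z. g c z v w) (chart_image c)" for v w
      using assms(2) c by (simp add: hermitian_metric_def)
    show "frechet_derivative (\<lambda>u. g c u (Y u) (Z u)) (at z) (X z) =
        g c z (cov (\<Gamma> c) X Y z) (Z z) + g c z (Y z) (cov (\<Gamma> c) X Z z)"
      if "smooth_on X (chart_image c)" "smooth_on Y (chart_image c)" "smooth_on Z (chart_image c)" "z \<in> chart_image c"
      for X Y Z z
      using assms(4) c that unfolding bismut_connection_def by blast
    show "cov (\<Gamma> c) X (\<lambda>u. J (Y u)) z = J (cov (\<Gamma> c) X Y z)"
      if "smooth_on X (chart_image c)" "smooth_on Y (chart_image c)" "z \<in> chart_image c" for X Y z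
      using assms(4) c that unfolding bismut_connection_def by blast
  qed
  have parallel: "cov (\<Gamma> c) W (curvature (\<Gamma> c) X Y Z) z = curvature (\<Gamma> c) (cov (\<Gamma> c) W X) Y Z z
      + curvature (\<Gamma> c) X (cov (\<Gamma> c) W Y) Z z + curvature (\<Gamma> c) X Y (cov (\<Gamma> c) W Z) z"
    if "smooth_on W (chart_image c)" "smooth_on X (chart_image c)" "smooth_on Y (chart_image c)"
      "smooth_on Z (chart_image c)" "z \<in> chart_image c" for W X Y Z z
  proof -
    have "cov (\<Gamma> c) W (curvature (\<Gamma> c) X Y Z) z
           - curvature (\<Gamma> c) (cov (\<Gamma> c) W X) Y Z z
           - curvature (\<Gamma> c) X (cov (\<Gamma> c) W Y) Z z
           - curvature (\<Gamma> c) X Y (cov (\<Gamma> c) W Z) z = 0"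
      using assms(5) c that unfolding ambrose_singer_def parallel_curvature_def by blast
    then show ?thesis by (simp add: algebra_simps)
  qed
  interpret kaehler_like_curvature "g c z" "R z"
  proof (rule kaehler_like_curvature_R[OF z parallel])
    fix x y u v :: "'n cvec"
    assume "type_10 x" "type_10 y" "type_10 u" "type_10 v"
    then show "curvatureC (g c) (\<Gamma> c) z x y u (conj_vec v) = 0 \<and>
      curvatureC (g c) (\<Gamma> c) z x (conj_vec y) u (conj_vec v) = curvatureC (g c) (\<Gamma> c) z u (conj_vec y) x (conj_vec v)"
      using assms(7) c z unfolding kaehler_like_def by blast
  qed
  have "R z x y w = 0" for x y w
  proof (rule ricci_flat_imp_zero)
    fix x :: "complex ^ 'n" and a :: "'n \<Rightarrow> complex ^ 'n"
    assume frame: "\<And>j k. g c z (a j) (a k) = (if j = k then 1/2 else 0)" "\<And>j k. g c z (a j) (J (a k)) = 0"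
    show "(\<Sum>i\<in>UNIV. g c z (R z x (J x) (a i)) (J (a i))) = 0"
    proof (rule first_ricci_real[OF z frame])
      show "first_ricci (g c) (\<Gamma> c) z e x y = 0" if "unitary_frame (g c) z e" for e x y
        using assms(6) c z that unfolding first_ricci_vanishes_def by blast
    qed
  qed
  then show "curvature (\<Gamma> c) X Y Z z = 0"
    by (simp add: curvature_tensorial[OF z sm])
qed

end
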